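(* Let $A,B\in\mathbb{R}^{n\times n}$ be nonzero symmetric matrices with $B$ positive semidefinite, let $\sigma\in\mathbb{R}$, $\sigma\ne0$, be such that $A-\sigma B$ is nonsingular, and let $C_a,D_a,C_b,X,W,U,\Theta$ be computed quantities satisfying the error bounds (1)–(6) listed in the context. Let $\theta_i\ne0$ be the $i$th diagonal entry of $\Theta$, let $u_i$ be the $i$th column of $U$, and let $\lambda_i=(1+\sigma\theta_i)/\theta_i$, i.e. $\theta_i=1/(\lambda_i-\sigma)$; assume $\lambda_i\neq0$. Let $$\eta=\frac{\|A-\sigma B\|_2^{1/2}}{\|B\|_2^{1/2}},\qquad \sigma_0=\sigma\frac{\|B\|_2}{\|A\|_2},\qquad \gamma=\frac{\|A\|_2}{\|A-\sigma B\|_2}.$$ Suppose $v_i$ is computed from $C_a^{T}v_i=D_aXu_i$ using a backward stable algorithm for the solution of the system and standard matrix-vector multiplication for forming the right-hand side (condition (7) in the context). Then $$\bigl\|\bigl(\theta_iA-(1+\sigma\theta_i)B\bigr)v_i\bigr\|_2\le |1+\sigma\theta_i|\cdot\Bigl|1-\frac{\sigma}{\lambda_i}\Bigr|\,\Bigl[u c_n+O(u)\Bigl(\eta\|X\|_2+\Bigl(1+\max(\gamma,1)\Bigl(1+\Bigl|1-\frac{\lambda_i}{\sigma}\Bigr|\Bigr)\Bigr)\eta^2\|X\|_2^2\Bigr)\Bigr]\|B\|_2\|v_i\|_2+O(u^2)$$ and $$\bigl\|\bigl(\theta_iA-(1+\sigma\theta_i)B\bigr)v_i\bigr\|_2\le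 |\theta_i|\cdot\Bigl|1-\frac{\lambda_i}{\sigma}\Bigr|\cdot|\sigma_0|\,\Bigl[u c_n+O(u)\Bigl(\eta\|X\|_2+\Bigl(1+\max(\gamma,1)\Bigl(1+\Bigl|1-\frac{\lambda_i}{\sigma}\Bigr|\Bigr)\Bigr)\eta^2\|X\|_2^2\Bigr)\Bigr]\|A\|_2\|v_i\|_2+O(u^2).$$
   Context: Here $u$ is the unit roundoff, and $a_n,b_n,c_n,d_n,e_n,f_n,g_n,p_n,q_n$ are positive functions of $n$. Floating point model: $\mathrm{fl}(x\circ y)=(x\circ y)(1+\delta)$, $|\delta|\le u$. The matrix $\breve A=\mathrm{fl}(A-\sigma B)$ is computed element-wise, i.e. $\breve a_{ij}=\bigl(a_{ij}-\sigma b_{ij}(1+\delta_{ij})\bigr)(1+\delta'_{ij})$ with $|\delta_{ij}|,|\delta'_{ij}|\le u$, and $\breve A=\breve A^T$. The quantities $C_a\in\mathbb{R}^{n\times n}$, $D_a$ (diagonal, entries $\pm1$), $C_b\in\mathbb{R}^{n\times r}$ ($r\le n$), $X\in\mathbb{R}^{n\times r}$, $W,U\in\mathbb{R}^{r\times r}$, and diagonal $\Theta\in\mathbb{R}^{r\times r}$ are computed by a spectral transformation algorithm (factor $A-\sigma B=C_aD_aC_a^T$, $B=C_bC_b^T$, solve $C_aX=C_b$, form $W=X^TD_aX$, decompose $W=U\Theta U^T$), with errors satisfying, for some orthogonal $\tilde U\in\mathbb{R}^{r\times r}$: (1) $\|\breve A-C_aD_aC_a^T\|_2\le u a_n\|\breve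 A\|_2$, $\|C_a\|_2\le b_n\|\breve A\|_2^{1/2}$; (2) $\|B-C_bC_b^T\|_2\le u c_n\|B\|_2$; (3) $\|C_aX-C_b\|_2\le u d_n\|C_a\|_2\|X\|_2$; (4) $\|W-X^TD_aX\|_2\le u e_n\|X\|_2^2$, $W=W^T$; (5) $\|W-\tilde U\Theta\tilde U^T\|_2\le u f_n\|W\|_2$; (6) $\|\tilde U-U\|_2\le u g_n$. (7) The stability assumption on the computation of $v_i$ means: there are matrices $J_1,J_2$ with $(C_a^T+J_1)v_i=D_a(X+J_2)u_i$, $\|J_1\|_2\le u\,p_n\|C_a\|_2$ and $\|J_2\|_2\le u\,q_n\|X\|_2$. Conventions. $O(u)$ denotes a quantity bounded by $h_nu$, where $h_n>0$ depends solely on $n$ (it may be built from $a_n,b_n,d_n,e_n,f_n,g_n,p_n,q_n$, but not from $c_n$) and not on $A$, $B$ or $\sigma$. The analysis is first order in $u$: $O(u^2)$ denotes a quantity bounded by $Ku^2\|v_i\|_2$ for all $0<u\le u_0$, where $K,u_0>0$ may depend on $n,A,B,\sigma$, the functions $a_n,\dots,g_n,p_n,q_n$ and a positive lower bound for $|\theta_i|$, uniformly over all quantities satisfying the hypotheses. *)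

theory Defs
  imports "Jordan_Normal_Form.Matrix" "HOL-Analysis.L2_Norm"
begin

(* Matrices are those of Jordan_Normal_Form.Matrix, whose dimensions are natural numbers in the
   logic: a function h of n can then be quantified before n and r. *)

definition vnorm2 :: "real vec \<Rightarrow> real" where
  "vnorm2 x = L2_set (\<lambda>i. x $ i) {..<dim_vec x}"

(* Spectral norm, as the supremum over the closed unit ball; unlike the unit sphere it is
   nonempty also when M has no columns. *)
definition mnorm2 :: "real mat \<Rightarrow> real" where
  "mnorm2 M = (SUP x \<in> {x \<in> carrier_vec (dim_col M). vnorm2 x \<le> 1}. vnorm2 (M *\<^sub>v x))"

definition sym_mat :: "real mat \<Rightarrow> bool" where
  "sym_mat M \<longleftrightarrow> transpose_mat M = M"

definition pos_semidef :: "nat \<Rightarrow> real mat \<Rightarrow> bool" where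
  "pos_semidef n M \<longleftrightarrow> M \<in> carrier_mat n n \<and> sym_mat M \<and>
     (\<forall>x \<in> carrier_vec n. 0 \<le> x \<bullet> (M *\<^sub>v x))"

(* Orthogonal in the usual sense. The library's orthogonal_mat is weaker: it only asks for
   pairwise orthogonal nonzero columns. *)
definition orthonormal_mat :: "nat \<Rightarrow> real mat \<Rightarrow> bool" where
  "orthonormal_mat r Q \<longleftrightarrow> Q \<in> carrier_mat r r \<and>
     transpose_mat Q * Q = 1\<^sub>m r \<and> Q * transpose_mat Q = 1\<^sub>m r"

(* Ab is a possible outcome of evaluating A - s B entrywise with unit roundoff u; dl is the
   relative error of the multiplication and dl' that of the subtraction. *)
definition fl_shifted :: "real \<Rightarrow> nat \<Rightarrow> real mat \<Rightarrow> real mat \<Rightarrow> real \<Rightarrow> real mat \<Rightarrow> bool" where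
  "fl_shifted u n A B s Ab \<longleftrightarrow> Ab \<in> carrier_mat n n \<and> sym_mat Ab \<and>
     (\<exists>dl dl' :: nat \<Rightarrow> nat \<Rightarrow> real. \<forall>i<n. \<forall>j<n.
        \<bar>dl i j\<bar> \<le> u \<and> \<bar>dl' i j\<bar> \<le> u \<and>
        Ab $$ (i,j) = (A $$ (i,j) - s * (B $$ (i,j) * (1 + dl i j))) * (1 + dl' i j))"

(* Factorization of the shifted matrix; the reals a and b are the values at n of the
   corresponding error functions, and similarly for c, ..., q below. *)
definition shifted_factor ::
  "real \<Rightarrow> nat \<Rightarrow> real \<Rightarrow> real \<Rightarrow> real mat \<Rightarrow> real mat \<Rightarrow> real mat \<Rightarrow> bool" where
  "shifted_factor u n a b Ab Ca Da \<longleftrightarrow>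
     Ca \<in> carrier_mat n n \<and> Da \<in> carrier_mat n n \<and>
     diagonal_mat Da \<and> (\<forall>i<n. Da $$ (i,i) = 1 \<or> Da $$ (i,i) = -1) \<and>
     mnorm2 (Ab - Ca * Da * transpose_mat Ca) \<le> u * a * mnorm2 Ab \<and>
     mnorm2 Ca \<le> b * sqrt (mnorm2 Ab)"

definition semidef_factor :: "real \<Rightarrow> nat \<Rightarrow> nat \<Rightarrow> real \<Rightarrow> real mat \<Rightarrow> real mat \<Rightarrow> bool" where
  "semidef_factor u n r c B Cb \<longleftrightarrow> Cb \<in> carrier_mat n r \<and>
     mnorm2 (B - Cb * transpose_mat Cb) \<le> u * c * mnorm2 B"

definition factor_solve ::
  "real \<Rightarrow> nat \<Rightarrow> nat \<Rightarrow> real \<Rightarrow> real mat \<Rightarrow> real mat \<Rightarrow> real mat \<Rightarrow> bool" where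
  "factor_solve u n r d Ca Cb X \<longleftrightarrow> X \<in> carrier_mat n r \<and>
     mnorm2 (Ca * X - Cb) \<le> u * d * mnorm2 Ca * mnorm2 X"

definition product_formed ::
  "real \<Rightarrow> nat \<Rightarrow> real \<Rightarrow> real mat \<Rightarrow> real mat \<Rightarrow> real mat \<Rightarrow> bool" where
  "product_formed u r e Da X W \<longleftrightarrow> W \<in> carrier_mat r r \<and> sym_mat W \<and>
     mnorm2 (W - transpose_mat X * Da * X) \<le> u * e * (mnorm2 X)\<^sup>2"

definition eig_decomposed ::
  "real \<Rightarrow> nat \<Rightarrow> real \<Rightarrow> real \<Rightarrow> real mat \<Rightarrow> real mat \<Rightarrow> real mat \<Rightarrow> bool" where
  "eig_decomposed u r f g W U Th \<longleftrightarrow>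
     U \<in> carrier_mat r r \<and> Th \<in> carrier_mat r r \<and> diagonal_mat Th \<and>
     (\<exists>Ut. orthonormal_mat r Ut \<and>
        mnorm2 (W - Ut * Th * transpose_mat Ut) \<le> u * f * mnorm2 W \<and>
        mnorm2 (Ut - U) \<le> u * g)"

(* v is computed from transpose Ca * v = Da * X * w in a backward stable manner. *)
definition stable_recovery ::
  "real \<Rightarrow> nat \<Rightarrow> nat \<Rightarrow> real \<Rightarrow> real \<Rightarrow> real mat \<Rightarrow> real mat \<Rightarrow> real mat \<Rightarrow> real vec \<Rightarrow> real vec \<Rightarrow> bool"
  where
  "stable_recovery u n r p q Ca Da X w v \<longleftrightarrow> v \<in> carrier_vec n \<and>
     (\<exists>J1 J2. J1 \<in> carrier_mat n n \<and> J2 \<in> carrier_mat n r \<and>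
        (transpose_mat Ca + J1) *\<^sub>v v = Da *\<^sub>v ((X + J2) *\<^sub>v w) \<and>
        mnorm2 J1 \<le> u * p * mnorm2 Ca \<and> mnorm2 J2 \<le> u * q * mnorm2 X)"

definition eta :: "real mat \<Rightarrow> real mat \<Rightarrow> real \<Rightarrow> real" where
  "eta A B s = sqrt (mnorm2 (A - s \<cdot>\<^sub>m B)) / sqrt (mnorm2 B)"

definition sigma0 :: "real mat \<Rightarrow> real mat \<Rightarrow> real \<Rightarrow> real" where
  "sigma0 A B s = s * mnorm2 B / mnorm2 A"

definition gam :: "real mat \<Rightarrow> real mat \<Rightarrow> real \<Rightarrow> real" where
  "gam A B s = mnorm2 A / mnorm2 (A - s \<cdot>\<^sub>m B)"

(* The common bracket of both bounds. The real hu is the value of the O(u) term and x that of the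
   norm of X. *)
definition bracket ::
  "real mat \<Rightarrow> real mat \<Rightarrow> real \<Rightarrow> real \<Rightarrow> real \<Rightarrow> real \<Rightarrow> real \<Rightarrow> real \<Rightarrow> real" where
  "bracket A B s u c hu l x =
     u * c + hu * (eta A B s * x +
       (1 + max (gam A B s) 1 * (1 + \<bar>1 - l / s\<bar>)) * (eta A B s)\<^sup>2 * x\<^sup>2)"

end

theory Submission
  imports Defs "Jordan_Normal_Form.Determinant"
begin

text \<open>Put \<open>M = A - \<sigma> B\<close>. Since \<open>(1 + \<sigma> \<theta>) (1 - \<sigma> / \<lambda>) = 1\<close> and
\<open>\<theta> (1 - \<lambda> / \<sigma>) = -1 / \<sigma>\<close>, both claims are the same bound on \<open>(\<theta> M - B) v\<close>,
in which \<open>\<eta>\<close> and \<open>\<gamma>\<close> turn the bracket times \<open>\<parallel>B\<parallel>\<close> into an expression in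
\<open>\<parallel>A\<parallel>\<close>, \<open>\<parallel>B\<parallel>\<close>, \<open>\<parallel>M\<parallel>\<close> and \<open>\<parallel>X\<parallel>\<close>. Expanding \<open>M\<close> as \<open>C D C\<^sup>T\<close> and
\<open>B\<close> as \<open>(C X) (C X)\<^sup>T\<close>, up to errors, the main terms cancel because \<open>D\<^sup>2 = I\<close> and
\<open>X\<^sup>T C\<^sup>T v\<close> is \<open>\<theta> u\<^sub>i\<close> plus a small residual. The eigensolver part of that residual is
proportional to \<open>\<parallel>X\<parallel>\<^sup>2 \<parallel>u\<^sub>i\<parallel>\<close>; it is paid for by
\<open>\<bar>\<theta>\<bar> \<parallel>u\<^sub>i\<parallel> \<le> 8 \<parallel>B\<parallel>\<^sup>1\<^sup>/\<^sup>2 \<parallel>v\<parallel>\<close>, the factor \<open>\<parallel>C X\<parallel> \<approx> \<parallel>B\<parallel>\<^sup>1\<^sup>/\<^sup>2\<close> and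
\<open>\<bar>\<sigma>\<bar> \<parallel>B\<parallel> \<le> \<parallel>A\<parallel> + \<parallel>M\<parallel>\<close>, whence the factor
\<open>max \<gamma> 1 / \<bar>\<theta> \<sigma>\<bar>\<close>. Invertibility of \<open>M\<close> bounds \<open>\<parallel>X\<parallel>\<close> uniformly, so for small \<open>u\<close>
every second-order term is absorbed by a first-order one.\<close>

subsection \<open>Euclidean and spectral norms\<close>

lemma vnorm2_nonneg [simp]: "0 \<le> vnorm2 x"
  by (simp add: vnorm2_def L2_set_nonneg)

lemma vnorm2_sq: "(vnorm2 x)\<^sup>2 = x \<bullet> x"
  by (simp add: vnorm2_def L2_set_def scalar_prod_def power2_eq_square sum_nonneg atLeast0LessThan)

lemma abs_scalar_prod_le:
  assumes "x \<in> carrier_vec n" "y \<in> carrier_vec n"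
  shows "\<bar>x \<bullet> y\<bar> \<le> vnorm2 x * vnorm2 y"
proof -
  have "\<bar>x \<bullet> y\<bar> \<le> (\<Sum>i<n. \<bar>x $ i\<bar> * \<bar>y $ i\<bar>)"
    using assms sum_abs[of "\<lambda>i. x $ i * y $ i" "{..<n}"]
    by (simp add: scalar_prod_def abs_mult atLeast0LessThan)
  also have "\<dots> \<le> vnorm2 x * vnorm2 y"
    using assms L2_set_mult_ineq[of "\<lambda>i. x $ i" "\<lambda>i. y $ i" "{..<n}"] by (simp add: vnorm2_def)
  finally show ?thesis .
qed

lemma vnorm2_add_le:
  assumes "x \<in> carrier_vec n" "y \<in> carrier_vec n"
  shows "vnorm2 (x + y) \<le> vnorm2 x + vnorm2 y"
proof -
  have "vnorm2 (x + y) = L2_set (\<lambda>i. x $ i + y $ i) {..<n}"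
    using assms by (auto simp: vnorm2_def intro!: L2_set_cong)
  then show ?thesis
    using assms L2_set_triangle_ineq[of "\<lambda>i. x $ i" "\<lambda>i. y $ i" "{..<n}"] by (simp add: vnorm2_def)
qed

lemma vnorm2_smult [simp]: "vnorm2 (k \<cdot>\<^sub>v x) = \<bar>k\<bar> * vnorm2 x"
proof -
  have "(vnorm2 (k \<cdot>\<^sub>v x))\<^sup>2 = (\<bar>k\<bar> * vnorm2 x)\<^sup>2"
    by (simp add: vnorm2_sq power_mult_distrib power2_eq_square[of k])
  then show ?thesis by (simp add: power2_eq_iff_nonneg)
qed

lemma vnorm2_uminus [simp]: "vnorm2 (- x) = vnorm2 (x :: real vec)"
  by (auto simp: vnorm2_def L2_set_def)

lemma vnorm2_diff_le:
  assumes "x \<in> carrier_vec n" "y \<in> carrier_vec n"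
  shows "vnorm2 (x - y) \<le> vnorm2 x + vnorm2 y"
proof -
  have "x - y = x + - y" using assms by (auto intro!: eq_vecI)
  then show ?thesis using vnorm2_add_le[of x n "- y"] assms by simp
qed

lemma vnorm2_zero [simp]: "vnorm2 (0\<^sub>v n) = 0"
  by (simp add: vnorm2_def L2_set_def)

lemma vnorm2_eq_0_iff:
  assumes "x \<in> carrier_vec n"
  shows "vnorm2 x = 0 \<longleftrightarrow> x = 0\<^sub>v n"
  using assms by (auto simp: vnorm2_def L2_set_eq_0_iff intro!: eq_vecI)

lemma abs_index_le_vnorm2:
  assumes "i < dim_vec x"
  shows "\<bar>x $ i\<bar> \<le> vnorm2 x"
  using member_le_L2_set[of "{..<dim_vec x}" i "\<lambda>i. \<bar>x $ i\<bar>"] assms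
  by (simp add: vnorm2_def L2_set_def)

lemma vnorm2_unit_vec:
  assumes "i < n"
  shows "vnorm2 (unit_vec n i) = 1"
  using vnorm2_sq[of "unit_vec n i"] assms vnorm2_nonneg[of "unit_vec n i"]
  by (simp add: power2_eq_1_iff)

section \<open>Spectral norm: basic inequalities\<close>

lemma mnorm2_bdd_above:
  "bdd_above ((\<lambda>x. vnorm2 (M *\<^sub>v x)) ` {x \<in> carrier_vec (dim_col M). vnorm2 x \<le> 1})"
proof (rule bdd_aboveI2)
  fix x assume x: "x \<in> {x \<in> carrier_vec (dim_col M). vnorm2 x \<le> 1}"
  \<comment> \<open>A real supremum carries information only for a bounded set. Cauchy-Schwarz on
    each row supplies a bound; its size does not matter, only that \<open>cSUP_upper\<close> becomes
    applicable.\<close>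
  have "vnorm2 (M *\<^sub>v x) \<le> (\<Sum>i<dim_row M. \<bar>(M *\<^sub>v x) $ i\<bar>)"
    using L2_set_le_sum_abs[of "\<lambda>i. (M *\<^sub>v x) $ i" "{..<dim_row M}"]
    by (simp add: vnorm2_def del: index_mult_mat_vec)
  also have "\<dots> \<le> (\<Sum>i<dim_row M. vnorm2 (row M i))"
  proof (rule sum_mono)
    fix i assume "i \<in> {..<dim_row M}"
    then have "\<bar>(M *\<^sub>v x) $ i\<bar> \<le> vnorm2 (row M i) * vnorm2 x"
      using abs_scalar_prod_le[of "row M i" "dim_col M" x] x by simp
    also have "\<dots> \<le> vnorm2 (row M i) * 1" using x by (intro mult_left_mono) auto
    finally show "\<bar>(M *\<^sub>v x) $ i\<bar> \<le> vnorm2 (row M i)" by simp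
  qed
  finally show "vnorm2 (M *\<^sub>v x) \<le> (\<Sum>i<dim_row M. vnorm2 (row M i))" .
qed

lemma mnorm2_nonneg [simp]: "0 \<le> mnorm2 M"
proof -
  have "vnorm2 (M *\<^sub>v 0\<^sub>v (dim_col M)) \<le> mnorm2 M"
    unfolding mnorm2_def by (rule cSUP_upper[OF _ mnorm2_bdd_above]) simp
  then show ?thesis using vnorm2_nonneg order_trans by blast
qed

text \<open>By homogeneity: \<open>x\<close> is rescaled to length 1, where the supremum applies. A
  vector of norm zero cannot be rescaled, but it is mapped to zero.\<close>

lemma vnorm2_mult_mat_vec_le:
  assumes M: "M \<in> carrier_mat m n" and x: "x \<in> carrier_vec n"
  shows "vnorm2 (M *\<^sub>v x) \<le> mnorm2 M * vnorm2 x"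
proof (cases "vnorm2 x = 0")
  case True
  then have "M *\<^sub>v x = 0\<^sub>v m" using vnorm2_eq_0_iff[OF x] M by (auto intro!: eq_vecI)
  then show ?thesis using True by simp
next
  case False
  let ?k = "1 / vnorm2 x"
  have "vnorm2 (M *\<^sub>v (?k \<cdot>\<^sub>v x)) \<le> mnorm2 M"
    unfolding mnorm2_def by (rule cSUP_upper[OF _ mnorm2_bdd_above]) (use x M False in auto)
  then have "?k * vnorm2 (M *\<^sub>v x) \<le> mnorm2 M"
    using mult_mat_vec[OF M x] by simp
  then show ?thesis using False vnorm2_nonneg[of x] by (simp add: field_simps)
qed

lemma vnorm2_mult_mat_vec_le_bound:
  assumes "M \<in> carrier_mat m n" "x \<in> carrier_vec n" "mnorm2 M \<le> k" "vnorm2 x \<le> t"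
  shows "vnorm2 (M *\<^sub>v x) \<le> k * t"
proof -
  have "0 \<le> k" using assms(3) mnorm2_nonneg[of M] by linarith
  then have "mnorm2 M * vnorm2 x \<le> k * t" using assms(3,4) by (intro mult_mono) auto
  then show ?thesis using vnorm2_mult_mat_vec_le[OF assms(1,2)] by linarith
qed

text \<open>The way in which spectral norms are bounded from above later on: \<open>k\<close> is
  tested on vectors only. Nonnegativity of \<open>k\<close> gives the step from
  \<open>k * vnorm2 x\<close> to \<open>k\<close> inside the unit ball.\<close>

lemma mnorm2_leI:
  assumes M: "M \<in> carrier_mat m n" and k: "0 \<le> k"
    and le: "\<And>x. x \<in> carrier_vec n \<Longrightarrow> vnorm2 (M *\<^sub>v x) \<le> k * vnorm2 x"
  shows "mnorm2 M \<le> k"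
  unfolding mnorm2_def
proof (rule cSUP_least)
  show "{x \<in> carrier_vec (dim_col M). vnorm2 x \<le> 1} \<noteq> {}"
    by (auto intro!: exI[of _ "0\<^sub>v (dim_col M)"])
next
  fix x assume "x \<in> {x \<in> carrier_vec (dim_col M). vnorm2 x \<le> 1}"
  then have "vnorm2 (M *\<^sub>v x) \<le> k * vnorm2 x" "k * vnorm2 x \<le> k * 1"
    using le[of x] M k by (auto intro!: mult_left_mono simp del: mult_1_right)
  then show "vnorm2 (M *\<^sub>v x) \<le> k" by simp
qed

lemma mnorm2_mult_le:
  assumes M: "M \<in> carrier_mat m n" and N: "N \<in> carrier_mat n k"
  shows "mnorm2 (M * N) \<le> mnorm2 M * mnorm2 N"
proof (rule mnorm2_leI)
  show "M * N \<in> carrier_mat m k" using M N by simp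
  fix x :: "real vec" assume x: "x \<in> carrier_vec k"
  have "vnorm2 (M *\<^sub>v (N *\<^sub>v x)) \<le> mnorm2 M * (mnorm2 N * vnorm2 x)"
    by (rule vnorm2_mult_mat_vec_le_bound[OF M])
      (use N x vnorm2_mult_mat_vec_le[OF N x] in auto)
  then show "vnorm2 (M * N *\<^sub>v x) \<le> mnorm2 M * mnorm2 N * vnorm2 x"
    using assoc_mult_mat_vec[OF M N x] by (simp add: mult.assoc)
qed simp

lemma mnorm2_add_le:
  assumes M: "M \<in> carrier_mat m n" and N: "N \<in> carrier_mat m n"
  shows "mnorm2 (M + N) \<le> mnorm2 M + mnorm2 N"
proof (rule mnorm2_leI)
  show "M + N \<in> carrier_mat m n" using M N by simp
  fix x :: "real vec" assume x: "x \<in> carrier_vec n"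
  have "vnorm2 ((M + N) *\<^sub>v x) \<le> vnorm2 (M *\<^sub>v x) + vnorm2 (N *\<^sub>v x)"
    using vnorm2_add_le[of "M *\<^sub>v x" m "N *\<^sub>v x"] add_mult_distrib_mat_vec[OF M N x] M N x by simp
  then show "vnorm2 ((M + N) *\<^sub>v x) \<le> (mnorm2 M + mnorm2 N) * vnorm2 x"
    using vnorm2_mult_mat_vec_le[OF M x] vnorm2_mult_mat_vec_le[OF N x] by (simp add: distrib_right)
qed simp

lemma mnorm2_smult_le:
  assumes M: "M \<in> carrier_mat m n"
  shows "mnorm2 (k \<cdot>\<^sub>m M) \<le> \<bar>k\<bar> * mnorm2 M"
proof (rule mnorm2_leI)
  show "k \<cdot>\<^sub>m M \<in> carrier_mat m n" using M by simp
  fix x :: "real vec" assume x: "x \<in> carrier_vec n"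
  have "(k \<cdot>\<^sub>m M) *\<^sub>v x = k \<cdot>\<^sub>v (M *\<^sub>v x)" using M x by (auto intro!: eq_vecI)
  then show "vnorm2 ((k \<cdot>\<^sub>m M) *\<^sub>v x) \<le> \<bar>k\<bar> * mnorm2 M * vnorm2 x"
    using vnorm2_mult_mat_vec_le[OF M x] by (simp add: mult.assoc mult_left_mono)
qed simp

lemma mnorm2_uminus_le:
  assumes M: "M \<in> carrier_mat m n"
  shows "mnorm2 (- M) \<le> mnorm2 M"
proof -
  have "- M = (-1) \<cdot>\<^sub>m M" by (auto intro!: eq_matI)
  then show ?thesis using mnorm2_smult_le[OF M, of "-1"] by simp
qed

lemma mnorm2_diff_le:
  assumes M: "M \<in> carrier_mat m n" and N: "N \<in> carrier_mat m n"
  shows "mnorm2 (M - N) \<le> mnorm2 M + mnorm2 N"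
proof -
  have "M - N = M + - N" using M N by (auto intro!: eq_matI)
  then show ?thesis using mnorm2_add_le[of M m n "- N"] mnorm2_uminus_le[OF N] M N by simp
qed

lemma scalar_prod_transpose:
  assumes "(M :: real mat) \<in> carrier_mat m n" "x \<in> carrier_vec m" "y \<in> carrier_vec n"
  shows "(transpose_mat M *\<^sub>v x) \<bullet> y = x \<bullet> (M *\<^sub>v y)"
  using transpose_vec_mult_scalar[OF assms(1,3,2)] assms
  by (metis comm_scalar_prod mult_mat_vec_carrier transpose_carrier_mat)

text \<open>Moving \<open>M\<close> across the inner product gives |M^T y|^2 = y . M (M^T y), which
  Cauchy-Schwarz bounds by |y| |M| |M^T y|; one factor |M^T y| then cancels.\<close>

lemma mnorm2_transpose_le:
  assumes M: "M \<in> carrier_mat m n"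
  shows "mnorm2 (transpose_mat M) \<le> mnorm2 M"
proof (rule mnorm2_leI)
  show "transpose_mat M \<in> carrier_mat n m" using M by simp
  fix y :: "real vec" assume y: "y \<in> carrier_vec m"
  let ?z = "transpose_mat M *\<^sub>v y"
  have z: "?z \<in> carrier_vec n" using M y by simp
  have "(vnorm2 ?z)\<^sup>2 = y \<bullet> (M *\<^sub>v ?z)"
    using scalar_prod_transpose[OF M y z] by (simp add: vnorm2_sq)
  also have "\<dots> \<le> vnorm2 y * vnorm2 (M *\<^sub>v ?z)"
    using abs_scalar_prod_le[OF y, of "M *\<^sub>v ?z"] M z by simp
  also have "\<dots> \<le> vnorm2 y * (mnorm2 M * vnorm2 ?z)"
    using vnorm2_mult_mat_vec_le[OF M z] by (simp add: mult_left_mono)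
  finally have "vnorm2 ?z * vnorm2 ?z \<le> (mnorm2 M * vnorm2 y) * vnorm2 ?z"
    by (simp add: power2_eq_square algebra_simps)
  then show "vnorm2 ?z \<le> mnorm2 M * vnorm2 y"
    by (cases "vnorm2 ?z = 0") (use vnorm2_nonneg[of ?z] in \<open>auto dest: mult_right_le_imp_le simp: order_less_le\<close>)
qed simp

lemma mnorm2_transpose:
  assumes M: "M \<in> carrier_mat m n"
  shows "mnorm2 (transpose_mat M) = mnorm2 M"
  using mnorm2_transpose_le[OF M] mnorm2_transpose_le[of "transpose_mat M" n m] M by simp

text \<open>|M^T y|^2 = y . (M M^T y) is at most |M M^T| |y|^2, so a root can be taken. This turns
  the error bound for \<open>Cb * transpose_mat Cb\<close> into a bound on
  \<open>Cb\<close>.\<close>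

lemma mnorm2_sq_le_mult_transpose:
  assumes M: "M \<in> carrier_mat m n"
  shows "(mnorm2 M)\<^sup>2 \<le> mnorm2 (M * transpose_mat M)"
proof -
  let ?G = "M * transpose_mat M"
  have G: "?G \<in> carrier_mat m m" using M by simp
  have "mnorm2 (transpose_mat M) \<le> sqrt (mnorm2 ?G)"
  proof (rule mnorm2_leI)
    show "transpose_mat M \<in> carrier_mat n m" using M by simp
    fix y :: "real vec" assume y: "y \<in> carrier_vec m"
    let ?z = "transpose_mat M *\<^sub>v y"
    have z: "?z \<in> carrier_vec n" using M y by simp
    have Gy: "?G *\<^sub>v y \<in> carrier_vec m" using mult_mat_vec_carrier[OF G y] .
    have "(vnorm2 ?z)\<^sup>2 = y \<bullet> (?G *\<^sub>v y)"
      using scalar_prod_transpose[OF M y z] M y by (simp add: vnorm2_sq)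
    also have "\<dots> \<le> vnorm2 y * vnorm2 (?G *\<^sub>v y)"
      using abs_scalar_prod_le[OF y Gy] by linarith
    also have "\<dots> \<le> vnorm2 y * (mnorm2 ?G * vnorm2 y)"
      using vnorm2_mult_mat_vec_le[OF G y] by (rule mult_left_mono) simp
    also have "\<dots> = (sqrt (mnorm2 ?G) * vnorm2 y)\<^sup>2"
      by (simp add: power_mult_distrib) (simp add: power2_eq_square)
    finally show "vnorm2 ?z \<le> sqrt (mnorm2 ?G) * vnorm2 y"
      by (rule power2_le_imp_le) simp
  qed simp
  then have "mnorm2 M \<le> sqrt (mnorm2 ?G)" using mnorm2_transpose[OF M] by simp
  then have "(mnorm2 M)\<^sup>2 \<le> (sqrt (mnorm2 ?G))\<^sup>2" by (intro power_mono) auto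
  then show ?thesis by simp
qed

lemma mult_unit_vec:
  assumes "(M :: real mat) \<in> carrier_mat m n" "j < n"
  shows "M *\<^sub>v unit_vec n j = col M j"
  using assms by (auto intro!: eq_vecI)

lemma vnorm2_col_le:
  assumes "M \<in> carrier_mat m n" "j < n"
  shows "vnorm2 (col M j) \<le> mnorm2 M"
  using vnorm2_mult_mat_vec_le[OF assms(1), of "unit_vec n j"] vnorm2_unit_vec[OF assms(2)]
    mult_unit_vec[OF assms] by simp

lemma abs_entry_le_mnorm2:
  assumes "M \<in> carrier_mat m n" "i < m" "j < n"
  shows "\<bar>M $$ (i,j)\<bar> \<le> mnorm2 M"
proof -
  have "\<bar>col M j $ i\<bar> \<le> vnorm2 (col M j)" by (rule abs_index_le_vnorm2) (use assms in auto)
  then show ?thesis using vnorm2_col_le[OF assms(1,3)] assms by simp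
qed

lemma mnorm2_pos:
  assumes M: "M \<in> carrier_mat m n" and "M \<noteq> 0\<^sub>m m n"
  shows "0 < mnorm2 M"
proof (rule ccontr)
  assume "\<not> 0 < mnorm2 M"
  then have "mnorm2 M \<le> 0" by simp
  then have "\<And>i j. i < m \<Longrightarrow> j < n \<Longrightarrow> M $$ (i,j) = 0"
    using abs_entry_le_mnorm2[OF M] by (meson abs_le_zero_iff order_trans)
  then have "M = 0\<^sub>m m n" using M by (auto intro!: eq_matI)
  then show False using assms by simp
qed

text \<open>Rounding errors are known entrywise; this carries them over to the spectral norm. The
  factor \<open>n\<close> is a product of two square roots: one from Cauchy-Schwarz within a row,
  one from summing \<open>n\<close> equal squares over the rows.\<close>

lemma mnorm2_le_max_entry:
  assumes M: "M \<in> carrier_mat n n" and k: "0 \<le> k"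
    and le: "\<And>i j. i < n \<Longrightarrow> j < n \<Longrightarrow> \<bar>M $$ (i,j)\<bar> \<le> k"
  shows "mnorm2 M \<le> n * k"
proof (rule mnorm2_leI[OF M])
  fix x :: "real vec" assume x: "x \<in> carrier_vec n"
  have row_le: "\<bar>(M *\<^sub>v x) $ i\<bar> \<le> k * (sqrt n * vnorm2 x)" if i: "i < n" for i
  proof -
    have "\<bar>(M *\<^sub>v x) $ i\<bar> \<le> (\<Sum>j<n. \<bar>M $$ (i,j)\<bar> * \<bar>x $ j\<bar>)"
      using M x i sum_abs[of "\<lambda>j. M $$ (i,j) * x $ j" "{..<n}"]
      by (simp add: scalar_prod_def abs_mult atLeast0LessThan)
    also have "\<dots> \<le> (\<Sum>j<n. k * (\<bar>1\<bar> * \<bar>x $ j\<bar>))"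
      using le[OF i] by (intro sum_mono) (auto intro!: mult_right_mono)
    also have "\<dots> = k * (\<Sum>j<n. \<bar>1\<bar> * \<bar>x $ j\<bar>)" by (simp only: sum_distrib_left)
    also have "\<dots> \<le> k * (sqrt n * vnorm2 x)"
      using L2_set_mult_ineq[of "\<lambda>_. 1" "\<lambda>j. x $ j" "{..<n}"] x k
      by (intro mult_left_mono) (auto simp: vnorm2_def L2_set_def)
    finally show ?thesis .
  qed
  have "vnorm2 (M *\<^sub>v x) \<le> L2_set (\<lambda>i. k * (sqrt n * vnorm2 x)) {..<n}"
  proof -
    have "vnorm2 (M *\<^sub>v x) = L2_set (\<lambda>i. \<bar>(M *\<^sub>v x) $ i\<bar>) {..<n}"
      using M by (simp add: vnorm2_def L2_set_def)
    then show ?thesis using row_le by (auto intro!: L2_set_mono)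
  qed
  also have "\<dots> = sqrt n * (k * (sqrt n * vnorm2 x))"
    using k by (simp add: L2_set_def real_sqrt_mult)
  finally show "vnorm2 (M *\<^sub>v x) \<le> n * k * vnorm2 x" by (simp add: mult_ac flip: mult.assoc[of "sqrt n" "sqrt n"])
qed (use k in simp)

subsection \<open>Perturbation of the individual steps\<close>

lemma diagonal_mult_vec_index:
  assumes "(D :: real mat) \<in> carrier_mat n n" "diagonal_mat D" "x \<in> carrier_vec n" "i < n"
  shows "(D *\<^sub>v x) $ i = D $$ (i,i) * x $ i"
proof -
  have "(D *\<^sub>v x) $ i = (\<Sum>j<n. D $$ (i,j) * x $ j)"
    using assms by (simp add: scalar_prod_def atLeast0LessThan)
  also have "\<dots> = (\<Sum>j<n. if j = i then D $$ (i,i) * x $ i else 0)"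
    using assms by (intro sum.cong) (auto simp: diagonal_mat_def)
  finally show ?thesis using assms by simp
qed

text \<open>The conditions that \<open>shifted_factor\<close> puts on \<open>Da\<close>. They make
  \<open>D\<close> its own inverse, which drives the cancellation, and an isometry, which keeps it
  out of the norm estimates.\<close>

definition signature_mat :: "nat \<Rightarrow> real mat \<Rightarrow> bool" where
  "signature_mat n D \<longleftrightarrow> D \<in> carrier_mat n n \<and> diagonal_mat D \<and>
     (\<forall>i<n. D $$ (i,i) = 1 \<or> D $$ (i,i) = -1)"

lemma signature_mat_involution:
  assumes "signature_mat n D" "x \<in> carrier_vec n"
  shows "D *\<^sub>v (D *\<^sub>v x) = x"
proof (rule eq_vecI)
  fix i assume i: "i < dim_vec x"
  have D: "D \<in> carrier_mat n n" "diagonal_mat D" "D $$ (i,i) * D $$ (i,i) = 1"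
    using assms i by (auto simp: signature_mat_def)
  have "(D *\<^sub>v (D *\<^sub>v x)) $ i = D $$ (i,i) * (D $$ (i,i) * x $ i)"
    using diagonal_mult_vec_index[OF D(1,2), of "D *\<^sub>v x" i] diagonal_mult_vec_index[OF D(1,2), of x i]
      assms(2) i D(1) by (simp del: index_mult_mat_vec)
  then show "(D *\<^sub>v (D *\<^sub>v x)) $ i = x $ i" using D(3) by (simp flip: mult.assoc)
qed (use assms in \<open>auto simp: signature_mat_def\<close>)

lemma signature_mat_isometry:
  assumes "signature_mat n D" "x \<in> carrier_vec n"
  shows "vnorm2 (D *\<^sub>v x) = vnorm2 x"
proof -
  have D: "D \<in> carrier_mat n n" "diagonal_mat D" using assms by (auto simp: signature_mat_def)
  have "((D *\<^sub>v x) $ i)\<^sup>2 = (x $ i)\<^sup>2" if "i < n" for i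
    using diagonal_mult_vec_index[OF D assms(2) that] assms(1) that
    by (auto simp: signature_mat_def power_mult_distrib simp del: index_mult_mat_vec)
  then show ?thesis using D assms(2)
    by (simp add: vnorm2_def L2_set_def del: index_mult_mat_vec)
qed

lemma mnorm2_signature_le:
  assumes "signature_mat n D"
  shows "mnorm2 D \<le> 1"
  by (rule mnorm2_leI[of D n n])
    (use assms signature_mat_isometry in \<open>auto simp: signature_mat_def\<close>)

lemma orthonormal_mat_isometry:
  assumes Q: "Q \<in> carrier_mat r r" "transpose_mat Q * Q = 1\<^sub>m r" and x: "x \<in> carrier_vec r"
  shows "vnorm2 (Q *\<^sub>v x) = vnorm2 x"
proof -
  have "(vnorm2 (Q *\<^sub>v x))\<^sup>2 = (transpose_mat Q *\<^sub>v (Q *\<^sub>v x)) \<bullet> x"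
    using scalar_prod_transpose[OF Q(1) _ x, of "Q *\<^sub>v x"] Q x by (simp add: vnorm2_sq)
  also have "transpose_mat Q *\<^sub>v (Q *\<^sub>v x) = x"
    using assoc_mult_mat_vec[of "transpose_mat Q" r r Q r x] Q x by simp
  finally show ?thesis by (simp add: power2_eq_iff_nonneg flip: vnorm2_sq)
qed

section \<open>Lower bounds from invertibility\<close>

lemma invertible_mat_lower_bound:
  assumes M: "M \<in> carrier_mat n n" and inv: "invertible_mat M"
  obtains m where "0 < m" "\<And>x. x \<in> carrier_vec n \<Longrightarrow> m * vnorm2 x \<le> vnorm2 (M *\<^sub>v x)"
proof -
  obtain N where N: "inverts_mat M N" "inverts_mat N M"
    using inv by (auto simp: invertible_mat_def)
  then have MN: "M * N = 1\<^sub>m n" and NM: "N * M = 1\<^sub>m (dim_row N)"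
    using M by (auto simp: inverts_mat_def)
  have "dim_col N = n" "dim_row N = n"
    using arg_cong[OF MN, of dim_col] arg_cong[OF NM, of dim_col] M by auto
  then have Nc: "N \<in> carrier_mat n n" by auto
  \<comment> \<open>Adding 1 keeps the divisor positive whatever the norm of the inverse is.\<close>
  let ?k = "mnorm2 N + 1"
  have k: "0 < ?k" using mnorm2_nonneg[of N] by linarith
  show ?thesis
  proof (rule that[of "1 / ?k"])
    fix x :: "real vec" assume x: "x \<in> carrier_vec n"
    have "N *\<^sub>v (M *\<^sub>v x) = x"
      using assoc_mult_mat_vec[OF Nc M x] NM Nc x by simp
    then have "vnorm2 x \<le> mnorm2 N * vnorm2 (M *\<^sub>v x)"
      using vnorm2_mult_mat_vec_le[OF Nc, of "M *\<^sub>v x"] M x by simp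
    also have "\<dots> \<le> ?k * vnorm2 (M *\<^sub>v x)" by (intro mult_right_mono) auto
    finally show "1 / ?k * vnorm2 x \<le> vnorm2 (M *\<^sub>v x)" using k by (simp add: field_simps)
  qed (use k in simp)
qed

text \<open>The lower bound makes C^T injective, so \<open>C\<close> has an inverse
  \<open>R\<close>; it also bounds R^T, hence \<open>R\<close>, by 1 / s, and
  \<open>X = R * (C * X)\<close>. The hypothesis concerns the transpose since it is C^T x that a
  lower bound on C D C^T x controls.\<close>

lemma mnorm2_le_mult_of_transpose_lower_bound:
  assumes C: "C \<in> carrier_mat n n" and X: "X \<in> carrier_mat n r" and s: "0 < s"
    and low: "\<And>x. x \<in> carrier_vec n \<Longrightarrow> s * vnorm2 x \<le> vnorm2 (transpose_mat C *\<^sub>v x)"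
  shows "s * mnorm2 X \<le> mnorm2 (C * X)"
proof -
  have Ct: "transpose_mat C \<in> carrier_mat n n" using C by simp
  have "det (transpose_mat C) \<noteq> 0"
  proof
    assume "det (transpose_mat C) = 0"
    then obtain w where w: "w \<in> carrier_vec n" "w \<noteq> 0\<^sub>v n" "transpose_mat C *\<^sub>v w = 0\<^sub>v n"
      using det_0_iff_vec_prod_zero[OF Ct] by blast
    then have "s * vnorm2 w \<le> 0" using low[OF w(1)] by simp
    then have "vnorm2 w = 0" using s vnorm2_nonneg[of w] by (simp add: mult_le_0_iff)
    then show False using w vnorm2_eq_0_iff[OF w(1)] by simp
  qed
  then have "det C \<noteq> 0" using det_transpose[OF C] by simp
  then have "C \<in> Units (ring_mat TYPE(real) n ())" by (rule det_non_zero_imp_unit[OF C])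
  then obtain R where R: "R \<in> carrier_mat n n" "R * C = 1\<^sub>m n"
    by (auto simp: Units_def ring_mat_def)
  have CtRt: "transpose_mat C * transpose_mat R = 1\<^sub>m n"
    using transpose_mult[OF R(1) C] R(2) by simp
  have "mnorm2 (transpose_mat R) \<le> 1 / s"
  proof (rule mnorm2_leI)
    show Rt: "transpose_mat R \<in> carrier_mat n n" using R by simp
    fix z :: "real vec" assume z: "z \<in> carrier_vec n"
    have "transpose_mat C *\<^sub>v (transpose_mat R *\<^sub>v z) = z"
      using assoc_mult_mat_vec[OF Ct Rt z] CtRt z by simp
    then have "s * vnorm2 (transpose_mat R *\<^sub>v z) \<le> vnorm2 z"
      using low[of "transpose_mat R *\<^sub>v z"] Rt z by simp
    then show "vnorm2 (transpose_mat R *\<^sub>v z) \<le> 1 / s * vnorm2 z" using s by (simp add: field_simps)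
  qed (use s in simp)
  then have Rn: "mnorm2 R \<le> 1 / s" using mnorm2_transpose[OF R(1)] by simp
  have "X = R * (C * X)" using assoc_mult_mat[OF R(1) C X] R X by simp
  then have "mnorm2 X \<le> mnorm2 R * mnorm2 (C * X)"
    using mnorm2_mult_le[OF R(1), of "C * X" r] C X by simp
  also have "\<dots> \<le> 1 / s * mnorm2 (C * X)" using Rn by (intro mult_right_mono) auto
  finally show ?thesis using s by (simp add: field_simps)
qed

section \<open>Errors of the shifted matrix, the eigendecomposition and the recovery\<close>

lemma fl_shifted_error:
  assumes fl: "fl_shifted u n A B s Ab" and A: "A \<in> carrier_mat n n" and B: "B \<in> carrier_mat n n"
    and u: "0 \<le> u" "u \<le> 1"
  shows "mnorm2 (Ab - (A - s \<cdot>\<^sub>m B)) \<le> n * (u * (2 * (\<bar>s\<bar> * mnorm2 B) + mnorm2 (A - s \<cdot>\<^sub>m B)))"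
proof (rule mnorm2_le_max_entry)
  let ?M = "A - s \<cdot>\<^sub>m B"
  have M: "?M \<in> carrier_mat n n" using A B by (simp add: minus_carrier_mat)
  show "Ab - ?M \<in> carrier_mat n n" using M by (simp add: minus_carrier_mat)
  show "0 \<le> u * (2 * (\<bar>s\<bar> * mnorm2 B) + mnorm2 ?M)" using u by simp
  fix i j assume ij: "i < n" "j < n"
  obtain dl dl' :: real where d: "\<bar>dl\<bar> \<le> u" "\<bar>dl'\<bar> \<le> u"
    and Ab: "Ab $$ (i,j) = (A $$ (i,j) - s * (B $$ (i,j) * (1 + dl))) * (1 + dl')"
    using fl ij by (auto simp: fl_shifted_def)
  \<comment> \<open>The error of the multiplication acts on the entry of s B, that of the
    subtraction on the exact entry of the shifted matrix.\<close>
  have "(Ab - ?M) $$ (i,j) = - (dl * (1 + dl')) * (s * B $$ (i,j)) + dl' * ?M $$ (i,j)"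
    using A B ij Ab by (simp add: algebra_simps)
  also have "\<bar>\<dots>\<bar> \<le> \<bar>dl\<bar> * \<bar>1 + dl'\<bar> * \<bar>s * B $$ (i,j)\<bar> + \<bar>dl'\<bar> * \<bar>?M $$ (i,j)\<bar>"
    by (rule order_trans[OF abs_triangle_ineq]) (simp add: abs_mult)
  \<comment> \<open>The 2 bounds |1 + dl'| for \<open>u\<close> at most 1; no entry exceeds the
    spectral norm.\<close>
  also have "\<dots> \<le> u * 2 * (\<bar>s\<bar> * mnorm2 B) + u * mnorm2 ?M"
    using d u abs_entry_le_mnorm2[OF B ij] abs_entry_le_mnorm2[OF M ij]
    by (intro add_mono mult_mono) (auto simp: abs_mult intro: mult_left_mono)
  finally show "\<bar>(Ab - ?M) $$ (i,j)\<bar> \<le> u * (2 * (\<bar>s\<bar> * mnorm2 B) + mnorm2 ?M)"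
    by (simp add: algebra_simps)
qed

text \<open>The column \<open>t\<close> of the orthogonal factor \<open>Q\<close> is an exact
  eigenvector of S = Q \<Theta> Q^T, and \<open>col U i\<close> is within \<open>u * g\<close> of
  it. Hence W y - \<theta> y is (W - S) y plus S - \<theta> applied to a small vector.\<close>

lemma eig_decomposed_column:
  assumes eig: "eig_decomposed u r f g W U \<Theta>" and W: "W \<in> carrier_mat r r" and i: "i < r"
    and u: "0 \<le> u" "u * f \<le> 1" "2 * (u * g) \<le> 1"
  defines "\<theta> \<equiv> \<Theta> $$ (i,i)"
  shows "\<bar>\<theta>\<bar> \<le> 2 * mnorm2 W" "1 / 2 \<le> vnorm2 (col U i)"
    "vnorm2 (W *\<^sub>v col U i - \<theta> \<cdot>\<^sub>v col U i) \<le> u * (8 * g + f) * mnorm2 W * vnorm2 (col U i)"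
proof -
  obtain Q where U: "U \<in> carrier_mat r r" and T: "\<Theta> \<in> carrier_mat r r" "diagonal_mat \<Theta>"
    and Q: "Q \<in> carrier_mat r r" "transpose_mat Q * Q = 1\<^sub>m r"
    and E: "mnorm2 (W - Q * \<Theta> * transpose_mat Q) \<le> u * f * mnorm2 W"
    and QU: "mnorm2 (Q - U) \<le> u * g"
    using eig by (auto simp: eig_decomposed_def orthonormal_mat_def)
  define S where "S = Q * \<Theta> * transpose_mat Q"
  have S: "S \<in> carrier_mat r r" using Q T by (simp add: S_def)
  define y where "y = col U i"
  define t where "t = col Q i"
  have y: "y \<in> carrier_vec r" and t: "t \<in> carrier_vec r"
    using U Q by (auto simp: y_def t_def intro!: carrier_vecI)
  have tu: "t = Q *\<^sub>v unit_vec r i" using mult_unit_vec[OF Q(1) i] by (simp add: t_def)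
  have t1: "vnorm2 t = 1"
    using orthonormal_mat_isometry[OF Q, of "unit_vec r i"] vnorm2_unit_vec[OF i] by (simp add: tu)
  have St: "S *\<^sub>v t = \<theta> \<cdot>\<^sub>v t"
  proof -
    have "transpose_mat Q *\<^sub>v t = unit_vec r i"
      using assoc_mult_mat_vec[of "transpose_mat Q" r r Q r "unit_vec r i"] Q by (simp add: tu)
    then have "S *\<^sub>v t = Q *\<^sub>v (\<Theta> *\<^sub>v unit_vec r i)"
      using assoc_mult_mat_vec[of "Q * \<Theta>" r r "transpose_mat Q" r t] Q T t by (simp add: S_def del: assoc_mult_mat)
    also have "\<Theta> *\<^sub>v unit_vec r i = \<theta> \<cdot>\<^sub>v unit_vec r i"
      using T i diagonal_mult_vec_index[OF T, of "unit_vec r i"]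
      by (intro eq_vecI) (auto simp: \<theta>_def unit_vec_def simp del: index_mult_mat_vec)
    finally show ?thesis using mult_mat_vec[OF Q(1)] by (simp add: tu)
  qed
  have Sn: "mnorm2 S \<le> 2 * mnorm2 W"
  proof -
    have "S = W - (W - S)" using S W by (auto intro!: eq_matI)
    then have "mnorm2 S \<le> mnorm2 W + mnorm2 (W - S)"
      using mnorm2_diff_le[OF W, of "W - S"] S W by (simp add: minus_carrier_mat)
    also have "mnorm2 (W - S) \<le> 1 * mnorm2 W"
      by (rule order_trans[OF E[folded S_def]]) (use u in \<open>intro mult_right_mono; simp\<close>)
    finally show ?thesis by simp
  qed
  show th: "\<bar>\<theta>\<bar> \<le> 2 * mnorm2 W"
    using vnorm2_mult_mat_vec_le_bound[OF S t Sn, of 1] St t1 by simp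
  define \<delta> where "\<delta> = y - t"
  have \<delta>: "\<delta> \<in> carrier_vec r" using y t by (simp add: \<delta>_def)
  have \<delta>n: "vnorm2 \<delta> \<le> u * g"
  proof -
    have "\<delta> = - col (Q - U) i" using Q U i by (auto simp: \<delta>_def y_def t_def intro!: eq_vecI)
    then have "vnorm2 \<delta> = vnorm2 (col (Q - U) i)" by simp
    also have "\<dots> \<le> mnorm2 (Q - U)" by (rule vnorm2_col_le) (use Q U i in \<open>auto simp: minus_carrier_mat\<close>)
    finally show ?thesis using QU by linarith
  qed
  have y2: "1 / 2 \<le> vnorm2 y"
  proof -
    have "t = y - \<delta>" using y t by (auto simp: \<delta>_def intro!: eq_vecI)
    then have "vnorm2 t \<le> vnorm2 y + vnorm2 \<delta>" using vnorm2_diff_le[OF y \<delta>] by simp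
    then show ?thesis using t1 \<delta>n u by linarith
  qed
  then show "1 / 2 \<le> vnorm2 (col U i)" by (simp add: y_def)
  \<comment> \<open>The lower bound on the length of \<open>y\<close> turns the absolute error
    \<open>u * g\<close> into one relative to \<open>y\<close>.\<close>
  have \<delta>y: "vnorm2 \<delta> \<le> 2 * (u * g) * vnorm2 y"
  proof -
    have "0 \<le> u * g" using \<delta>n vnorm2_nonneg[of \<delta>] by linarith
    then have "u * g * 1 \<le> u * g * (2 * vnorm2 y)" using y2 by (intro mult_left_mono) auto
    then show ?thesis using \<delta>n by simp
  qed
  have "W *\<^sub>v y - \<theta> \<cdot>\<^sub>v y = (W - S) *\<^sub>v y + (S *\<^sub>v \<delta> - \<theta> \<cdot>\<^sub>v \<delta>)"
  proof -
    have S\<delta>: "S *\<^sub>v (y - t) = S *\<^sub>v y - \<theta> \<cdot>\<^sub>v t"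
      using mult_minus_distrib_mat_vec[OF S y t] St by simp
    have "h - \<theta> \<cdot>\<^sub>v y = (h - s) + (s - \<theta> \<cdot>\<^sub>v t - \<theta> \<cdot>\<^sub>v (y - t))"
      if "h \<in> carrier_vec r" "s \<in> carrier_vec r" for h s :: "real vec"
      using that y t by (auto intro!: eq_vecI simp: right_diff_distrib)
    then show ?thesis
      unfolding \<delta>_def S\<delta> minus_mult_distrib_mat_vec[OF W S y]
      using mult_mat_vec_carrier[OF W y] mult_mat_vec_carrier[OF S y] by blast
  qed
  \<comment> \<open>\<open>S\<close> and \<theta> are both at most 2 |W|, and \<delta> is at most 2
    u g |y|: two terms with factor 4 make the constant 8.\<close>
  then have "vnorm2 (W *\<^sub>v y - \<theta> \<cdot>\<^sub>v y) \<le> vnorm2 ((W - S) *\<^sub>v y) + vnorm2 (S *\<^sub>v \<delta> - \<theta> \<cdot>\<^sub>v \<delta>)"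
    using vnorm2_add_le[of "(W - S) *\<^sub>v y" r "S *\<^sub>v \<delta> - \<theta> \<cdot>\<^sub>v \<delta>"] W S y \<delta>
    by (simp add: minus_carrier_mat minus_carrier_vec mult_mat_vec_carrier[of _ r r])
  also have "vnorm2 (S *\<^sub>v \<delta> - \<theta> \<cdot>\<^sub>v \<delta>) \<le> vnorm2 (S *\<^sub>v \<delta>) + \<bar>\<theta>\<bar> * vnorm2 \<delta>"
    using vnorm2_diff_le[of "S *\<^sub>v \<delta>" r "\<theta> \<cdot>\<^sub>v \<delta>"] S \<delta> by simp
  also have "vnorm2 (S *\<^sub>v \<delta>) \<le> 2 * mnorm2 W * (2 * (u * g) * vnorm2 y)"
    by (rule vnorm2_mult_mat_vec_le_bound[OF S \<delta> Sn \<delta>y])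
  also have "\<bar>\<theta>\<bar> * vnorm2 \<delta> \<le> 2 * mnorm2 W * (2 * (u * g) * vnorm2 y)"
    by (rule mult_mono[OF th \<delta>y]) auto
  also have "vnorm2 ((W - S) *\<^sub>v y) \<le> u * f * mnorm2 W * vnorm2 y"
    by (rule vnorm2_mult_mat_vec_le_bound[of _ r r])
      (use W S y E in \<open>auto simp: S_def minus_carrier_mat\<close>)
  finally show "vnorm2 (W *\<^sub>v col U i - \<theta> \<cdot>\<^sub>v col U i) \<le> u * (8 * g + f) * mnorm2 W * vnorm2 (col U i)"
    by (simp add: y_def algebra_simps)
qed

text \<open>Solved for C^T v, the perturbed system gives D X y + D J2 y - J1 v. Multiplying by X^T
  produces X^T D X y, which is close to W y and so to \<theta> y. Forming \<open>W\<close>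
  contributes \<open>e\<close>, \<open>J2\<close> and \<open>J1\<close> contribute \<open>q\<close>
  and \<open>p\<close>, and \<open>k\<close> is the eigenvector residual.\<close>

lemma transformed_solve_residual:
  assumes C: "C \<in> carrier_mat n n" and D: "signature_mat n D" and X: "X \<in> carrier_mat n r"
    and W: "product_formed u r e D X W"
    and J: "J1 \<in> carrier_mat n n" "J2 \<in> carrier_mat n r"
    and y: "y \<in> carrier_vec r" and v: "v \<in> carrier_vec n"
    and solve: "(transpose_mat C + J1) *\<^sub>v v = D *\<^sub>v ((X + J2) *\<^sub>v y)"
    and J1n: "mnorm2 J1 \<le> u * p * mnorm2 C" and J2n: "mnorm2 J2 \<le> u * q * mnorm2 X"
    and Wn: "vnorm2 (W *\<^sub>v y - \<theta> \<cdot>\<^sub>v y) \<le> k * vnorm2 y"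
  defines "z \<equiv> transpose_mat X *\<^sub>v (transpose_mat C *\<^sub>v v)"
  shows "vnorm2 (z - \<theta> \<cdot>\<^sub>v y)
     \<le> (k + u * (e + q) * (mnorm2 X)\<^sup>2) * vnorm2 y + u * p * mnorm2 X * mnorm2 C * vnorm2 v"
proof -
  let ?x = "mnorm2 X" and ?Xt = "transpose_mat X" and ?Ct = "transpose_mat C"
  have Dc: "D \<in> carrier_mat n n" using D by (simp add: signature_mat_def)
  have Wc: "W \<in> carrier_mat r r" and We: "mnorm2 (W - ?Xt * D * X) \<le> u * e * ?x\<^sup>2"
    using W by (auto simp: product_formed_def)
  have Xt: "?Xt \<in> carrier_mat r n" and Ct: "?Ct \<in> carrier_mat n n" using X C by simp_all
  let ?G = "?Xt * D * X"
  have G: "?G \<in> carrier_mat r r" using Xt Dc X by simp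
  have Gy: "?G *\<^sub>v y = ?Xt *\<^sub>v (D *\<^sub>v (X *\<^sub>v y))"
    using assoc_mult_mat_vec[of "?Xt * D" r n X r y] Xt Dc X y by (simp del: assoc_mult_mat)
  define j1 where "j1 = J1 *\<^sub>v v"
  define j2 where "j2 = D *\<^sub>v (J2 *\<^sub>v y)"
  have j: "j1 \<in> carrier_vec n" "j2 \<in> carrier_vec n"
    using J Dc y v by (auto simp: j1_def j2_def)
  have DXy: "D *\<^sub>v (X *\<^sub>v y) \<in> carrier_vec n" using Dc X y by simp
  have Cv: "?Ct *\<^sub>v v = D *\<^sub>v (X *\<^sub>v y) + j2 - j1"
  proof -
    have "?Ct *\<^sub>v v + j1 = D *\<^sub>v (X *\<^sub>v y + J2 *\<^sub>v y)"
      using solve unfolding j1_def add_mult_distrib_mat_vec[OF Ct J(1) v] add_mult_distrib_mat_vec[OF X J(2) y] .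
    also have "\<dots> = D *\<^sub>v (X *\<^sub>v y) + j2"
      unfolding j2_def
      by (rule mult_add_distrib_mat_vec[OF Dc mult_mat_vec_carrier[OF X y] mult_mat_vec_carrier[OF J(2) y]])
    finally have "?Ct *\<^sub>v v + j1 = D *\<^sub>v (X *\<^sub>v y) + j2" .
    moreover have "?Ct *\<^sub>v v = ?Ct *\<^sub>v v + j1 - j1"
      using Ct v j by (intro eq_vecI) (auto simp del: index_mult_mat_vec)
    ultimately show ?thesis by simp
  qed
  have z: "z = ?G *\<^sub>v y + ?Xt *\<^sub>v j2 - ?Xt *\<^sub>v j1"
    unfolding z_def Cv Gy mult_minus_distrib_mat_vec[OF Xt add_carrier_vec[OF DXy j(2)] j(1)]
      mult_add_distrib_mat_vec[OF Xt DXy j(2)] ..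
  define w where "w = (W - ?G) *\<^sub>v y"
  define e' where "e' = W *\<^sub>v y - \<theta> \<cdot>\<^sub>v y"
  have w: "w = W *\<^sub>v y - ?G *\<^sub>v y"
    unfolding w_def by (rule minus_mult_distrib_mat_vec[OF Wc G y])
  have car: "w \<in> carrier_vec r" "e' \<in> carrier_vec r" "?Xt *\<^sub>v j2 \<in> carrier_vec r" "?Xt *\<^sub>v j1 \<in> carrier_vec r"
    "W *\<^sub>v y \<in> carrier_vec r" "?G *\<^sub>v y \<in> carrier_vec r"
    using mult_mat_vec_carrier[OF Wc y] mult_mat_vec_carrier[OF G y] y
      mult_mat_vec_carrier[OF Xt j(1)] mult_mat_vec_carrier[OF Xt j(2)]
    unfolding w e'_def by (blast intro: minus_carrier_vec smult_carrier_vec[THEN iffD2])+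
  \<comment> \<open>Inserting W y separates the eigenvector residual \<open>e'\<close> from the
    error \<open>w\<close> of forming the product.\<close>
  have eq: "z - \<theta> \<cdot>\<^sub>v y = (e' - w) + (?Xt *\<^sub>v j2 - ?Xt *\<^sub>v j1)"
  proof -
    have "c + a - b - t = (h - t - (h - c)) + (a - b)"
      if "a \<in> carrier_vec r" "b \<in> carrier_vec r" "c \<in> carrier_vec r" "h \<in> carrier_vec r"
        "t \<in> carrier_vec r" for a b c h t :: "real vec"
      using that by (auto intro!: eq_vecI)
    from this[OF car(3,4,6,5), of "\<theta> \<cdot>\<^sub>v y"] show ?thesis
      unfolding z w e'_def using y by (simp only: smult_carrier_vec)
  qed
  have "vnorm2 (z - \<theta> \<cdot>\<^sub>v y) \<le> (vnorm2 e' + vnorm2 w) + (vnorm2 (?Xt *\<^sub>v j2) + vnorm2 (?Xt *\<^sub>v j1))"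
    unfolding eq
    by (intro order_trans[OF vnorm2_add_le[of _ r]] add_mono vnorm2_diff_le[of _ r] minus_carrier_vec car)
  moreover have "vnorm2 e' \<le> k * vnorm2 y" using Wn by (simp add: e'_def)
  moreover have "vnorm2 w \<le> u * e * ?x\<^sup>2 * vnorm2 y"
    unfolding w_def by (rule vnorm2_mult_mat_vec_le_bound[OF minus_carrier_mat[OF G] y We]) simp
  moreover have "vnorm2 (?Xt *\<^sub>v j2) \<le> ?x * (u * q * ?x * vnorm2 y)"
  proof (rule vnorm2_mult_mat_vec_le_bound[OF Xt j(2)])
    have "vnorm2 j2 = vnorm2 (J2 *\<^sub>v y)"
      unfolding j2_def by (rule signature_mat_isometry[OF D]) (use J y in simp)
    then show "vnorm2 j2 \<le> u * q * ?x * vnorm2 y"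
      using vnorm2_mult_mat_vec_le_bound[OF J(2) y J2n] by simp
  qed (use mnorm2_transpose[OF X] in simp)
  moreover have "vnorm2 (?Xt *\<^sub>v j1) \<le> ?x * (u * p * mnorm2 C * vnorm2 v)"
    by (rule vnorm2_mult_mat_vec_le_bound[OF Xt j(1)])
      (use mnorm2_transpose[OF X] vnorm2_mult_mat_vec_le_bound[OF J(1) v J1n] in \<open>auto simp: j1_def\<close>)
  ultimately have "vnorm2 (z - \<theta> \<cdot>\<^sub>v y)
      \<le> k * vnorm2 y + u * e * ?x\<^sup>2 * vnorm2 y + ?x * (u * q * ?x * vnorm2 y) + ?x * (u * p * mnorm2 C * vnorm2 v)"
    by linarith
  also have "\<dots> = (k + u * (e + q) * ?x\<^sup>2) * vnorm2 y + u * p * ?x * mnorm2 C * vnorm2 v"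
    by (simp add: algebra_simps power2_eq_square)
  finally show ?thesis .
qed

section \<open>Norms of the computed factors\<close>

lemma shifted_factor_bounds:
  assumes sf: "shifted_factor u n a b Ab C D" and Ab: "Ab \<in> carrier_mat n n" and M: "M \<in> carrier_mat n n"
    and close: "mnorm2 (Ab - M) \<le> mnorm2 M" and b: "0 \<le> b" and ua: "0 \<le> u * a"
  shows "signature_mat n D" "mnorm2 (Ab - C * D * transpose_mat C) \<le> 2 * (u * a) * mnorm2 M"
    "(mnorm2 C)\<^sup>2 \<le> 2 * b\<^sup>2 * mnorm2 M" "mnorm2 C \<le> 2 * b * sqrt (mnorm2 M)"
proof -
  show "signature_mat n D" using sf by (simp add: shifted_factor_def signature_mat_def)
  have "Ab = M + (Ab - M)" using M Ab by (auto intro!: eq_matI)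
  \<comment> \<open>From here on the norm of the exact matrix \<open>M\<close> can stand for that of
    the rounded one, at the price of a factor 2.\<close>
  then have Abn: "mnorm2 Ab \<le> 2 * mnorm2 M"
    using mnorm2_add_le[OF M, of "Ab - M"] close M by (simp add: minus_carrier_mat)
  have "mnorm2 (Ab - C * D * transpose_mat C) \<le> u * a * mnorm2 Ab"
    using sf by (simp add: shifted_factor_def)
  also have "\<dots> \<le> u * a * (2 * mnorm2 M)" by (rule mult_left_mono[OF Abn ua])
  finally show "mnorm2 (Ab - C * D * transpose_mat C) \<le> 2 * (u * a) * mnorm2 M" by simp
  have "(mnorm2 C)\<^sup>2 \<le> (b * sqrt (mnorm2 Ab))\<^sup>2"
    using sf by (intro power_mono) (auto simp: shifted_factor_def)
  also have "\<dots> = b\<^sup>2 * mnorm2 Ab" by (simp add: power_mult_distrib)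
  also have "\<dots> \<le> b\<^sup>2 * (2 * mnorm2 M)" by (rule mult_left_mono[OF Abn]) simp
  finally show C2: "(mnorm2 C)\<^sup>2 \<le> 2 * b\<^sup>2 * mnorm2 M" by simp
  \<comment> \<open>The constant 2 in place of the square root of 2 keeps later constants
    integral.\<close>
  also have "\<dots> \<le> (2 * b * sqrt (mnorm2 M))\<^sup>2" by (simp add: power_mult_distrib mult_right_mono)
  finally show "mnorm2 C \<le> 2 * b * sqrt (mnorm2 M)"
    by (rule power2_le_imp_le) (use b in simp)
qed

text \<open>|Cb|^2 is at most |Cb Cb^T|, hence at most 2 |B| once \<open>u * c\<close> is at most 1.
  So \<open>c\<close> disappears into a numerical constant and stays out of the O(u) factor, which
  must not depend on it.\<close>

lemma semidef_factor_bound: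
  assumes sf: "semidef_factor u n r c B Cb" and B: "B \<in> carrier_mat n n" and uc: "u * c \<le> 1"
  shows "mnorm2 Cb \<le> 2 * sqrt (mnorm2 B)"
proof -
  have Cb: "Cb \<in> carrier_mat n r" using sf by (simp add: semidef_factor_def)
  let ?G = "Cb * transpose_mat Cb"
  have G: "?G \<in> carrier_mat n n" using Cb by simp
  have "?G = B - (B - ?G)" using B G by (auto intro!: eq_matI)
  then have "mnorm2 ?G \<le> mnorm2 B + mnorm2 (B - ?G)"
    using mnorm2_diff_le[OF B, of "B - ?G"] G by (simp add: minus_carrier_mat)
  also have "mnorm2 (B - ?G) \<le> u * c * mnorm2 B" using sf by (simp add: semidef_factor_def)
  also have "u * c * mnorm2 B \<le> 1 * mnorm2 B" using uc by (intro mult_right_mono) auto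
  finally have "(mnorm2 Cb)\<^sup>2 \<le> 2 * mnorm2 B"
    using mnorm2_sq_le_mult_transpose[OF Cb] by linarith
  also have "\<dots> \<le> (2 * sqrt (mnorm2 B))\<^sup>2" by (simp add: power_mult_distrib)
  finally show ?thesis by (rule power2_le_imp_le) simp
qed

lemma factor_solve_bound:
  assumes fs: "factor_solve u n r d C Cb X" and C: "C \<in> carrier_mat n n" and Cb: "Cb \<in> carrier_mat n r"
  shows "mnorm2 (C * X) \<le> mnorm2 Cb + u * d * mnorm2 C * mnorm2 X"
proof -
  have X: "X \<in> carrier_mat n r" and E: "mnorm2 (C * X - Cb) \<le> u * d * mnorm2 C * mnorm2 X"
    using fs by (auto simp: factor_solve_def)
  have "C * X = Cb + (C * X - Cb)" using C X Cb by (auto intro!: eq_matI)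
  then show ?thesis using mnorm2_add_le[OF Cb, of "C * X - Cb"] E C X Cb
    by (simp add: minus_carrier_mat)
qed

text \<open>\<open>M\<close> is bounded below by \<open>m\<close> and C D C^T lies within m / 2 of
  it, so C D C^T is bounded below by m / 2. As \<open>D\<close> preserves lengths, this passes to
  C^T at the cost of a factor 1 / k. It serves to bound \<open>X\<close> independently of
  \<open>u\<close>.\<close>

lemma mnorm2_solution_le:
  assumes M: "M \<in> carrier_mat n n" and C: "C \<in> carrier_mat n n" and D: "signature_mat n D"
    and X: "X \<in> carrier_mat n r"
    and low: "\<And>x. x \<in> carrier_vec n \<Longrightarrow> m * vnorm2 x \<le> vnorm2 (M *\<^sub>v x)"
    and F: "mnorm2 (C * D * transpose_mat C - M) \<le> m / 2"
    and Cn: "mnorm2 C \<le> k" and m: "0 < m" and k: "0 < k"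
  shows "m / (2 * k) * mnorm2 X \<le> mnorm2 (C * X)"
proof (rule mnorm2_le_mult_of_transpose_lower_bound[OF C X])
  have Dc: "D \<in> carrier_mat n n" using D by (simp add: signature_mat_def)
  let ?Ct = "transpose_mat C"
  have Ct: "?Ct \<in> carrier_mat n n" using C by simp
  fix x :: "real vec" assume x: "x \<in> carrier_vec n"
  let ?G = "C * D * ?Ct"
  have G: "?G \<in> carrier_mat n n" using C Dc by simp
  have Mx: "M *\<^sub>v x \<in> carrier_vec n" and Gx: "?G *\<^sub>v x \<in> carrier_vec n"
    using mult_mat_vec_carrier[OF M x] mult_mat_vec_carrier[OF G x] by blast+
  have "M *\<^sub>v x = ?G *\<^sub>v x - (?G - M) *\<^sub>v x"
    using minus_mult_distrib_mat_vec[OF G M x] Mx Gx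
    by (auto intro!: eq_vecI simp del: index_mult_mat_vec assoc_mult_mat_vec)
  then have "vnorm2 (M *\<^sub>v x) \<le> vnorm2 (?G *\<^sub>v x) + vnorm2 ((?G - M) *\<^sub>v x)"
    using vnorm2_diff_le[OF Gx, of "(?G - M) *\<^sub>v x"] M x mult_mat_vec_carrier[of "?G - M" n n x]
    by (simp add: minus_carrier_mat)
  moreover have "vnorm2 ((?G - M) *\<^sub>v x) \<le> m / 2 * vnorm2 x"
    by (rule vnorm2_mult_mat_vec_le_bound[of _ n n]) (use M x F in \<open>auto simp: minus_carrier_mat\<close>)
  moreover have "vnorm2 (?G *\<^sub>v x) \<le> k * vnorm2 (?Ct *\<^sub>v x)"
  proof -
    have Dx: "D *\<^sub>v (?Ct *\<^sub>v x) \<in> carrier_vec n" using Dc Ct x by simp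
    have "?G *\<^sub>v x = C *\<^sub>v (D *\<^sub>v (?Ct *\<^sub>v x))"
      using assoc_mult_mat_vec[of "C * D" n n ?Ct n x] C Dc Ct x by simp
    then show ?thesis
      using vnorm2_mult_mat_vec_le_bound[OF C Dx Cn order_refl] signature_mat_isometry[OF D, of "?Ct *\<^sub>v x"]
        Ct x by simp
  qed
  ultimately have "m * vnorm2 x \<le> k * vnorm2 (?Ct *\<^sub>v x) + m / 2 * vnorm2 x"
    using low[OF x] by linarith
  then have "m * vnorm2 x \<le> 2 * (k * vnorm2 (?Ct *\<^sub>v x))" by simp
  then show "m / (2 * k) * vnorm2 x \<le> vnorm2 (?Ct *\<^sub>v x)" using k by (simp add: field_simps)
qed (use m k in simp)

section \<open>Expansion of the residual into error terms\<close>

lemma vnorm2_residual_triangle: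
  fixes \<theta> :: real
  assumes "a1 \<in> carrier_vec n" "a2 \<in> carrier_vec n" "a3 \<in> carrier_vec n" "a4 \<in> carrier_vec n"
    "a5 \<in> carrier_vec n" "b1 \<in> carrier_vec n" "b2 \<in> carrier_vec n" "b3 \<in> carrier_vec n"
    "b4 \<in> carrier_vec n"
  shows "vnorm2 (\<theta> \<cdot>\<^sub>v (a1 + a2 - a3 + a4 - a5) - (b1 + (\<theta> \<cdot>\<^sub>v a1 + b2 - b3 - b4)))
    \<le> \<bar>\<theta>\<bar> * (vnorm2 a2 + vnorm2 a3 + vnorm2 a4 + vnorm2 a5)
        + vnorm2 b1 + vnorm2 b2 + vnorm2 b3 + vnorm2 b4"
proof -
  \<comment> \<open>The two copies of \<theta> a1 cancel before any norm is taken; in the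
    application the eight remaining vectors all carry an error factor.\<close>
  have "\<theta> \<cdot>\<^sub>v (a1 + a2 - a3 + a4 - a5) - (b1 + (\<theta> \<cdot>\<^sub>v a1 + b2 - b3 - b4))
      = \<theta> \<cdot>\<^sub>v ((a2 - a3) + (a4 - a5)) - ((b1 + b2) - (b3 + b4))"
    using assms by (auto intro!: eq_vecI simp: algebra_simps)
  moreover have "vnorm2 (\<theta> \<cdot>\<^sub>v ((a2 - a3) + (a4 - a5)))
      \<le> \<bar>\<theta>\<bar> * ((vnorm2 a2 + vnorm2 a3) + (vnorm2 a4 + vnorm2 a5))"
    unfolding vnorm2_smult using assms
    by (intro mult_left_mono order_trans[OF vnorm2_add_le[of _ n]] add_mono vnorm2_diff_le[of _ n]) auto
  moreover have "vnorm2 ((b1 + b2) - (b3 + b4)) \<le> (vnorm2 b1 + vnorm2 b2) + (vnorm2 b3 + vnorm2 b4)"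
    using assms
    by (intro order_trans[OF vnorm2_diff_le[of _ n]] add_mono vnorm2_add_le[of _ n]) auto
  moreover have "vnorm2 (\<theta> \<cdot>\<^sub>v ((a2 - a3) + (a4 - a5)) - ((b1 + b2) - (b3 + b4)))
      \<le> vnorm2 (\<theta> \<cdot>\<^sub>v ((a2 - a3) + (a4 - a5))) + vnorm2 ((b1 + b2) - (b3 + b4))"
    using assms by (intro vnorm2_diff_le[of _ n]) auto
  ultimately show ?thesis by (simp add: algebra_simps)
qed

text \<open>Both \<theta> M v and B v contain the main term \<theta> C X y. The first does because C
  D C^T v = C D D (X + J2) y - C D J1 v with D^2 = I, the second because X^T C^T v is \<theta> y up
  to the residual of the recovery.\<close>

lemma residual_decomposition:
  assumes M: "M \<in> carrier_mat n n" and B: "B \<in> carrier_mat n n" and Ab: "Ab \<in> carrier_mat n n"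
    and C: "C \<in> carrier_mat n n" and D: "signature_mat n D" and Cb: "Cb \<in> carrier_mat n r"
    and X: "X \<in> carrier_mat n r" and J: "J1 \<in> carrier_mat n n" "J2 \<in> carrier_mat n r"
    and y: "y \<in> carrier_vec r" and v: "v \<in> carrier_vec n"
    and solve: "(transpose_mat C + J1) *\<^sub>v v = D *\<^sub>v ((X + J2) *\<^sub>v y)"
  defines "E \<equiv> C * X - Cb" and "z \<equiv> transpose_mat X *\<^sub>v (transpose_mat C *\<^sub>v v)"
  shows "vnorm2 (\<theta> \<cdot>\<^sub>v (M *\<^sub>v v) - B *\<^sub>v v)
    \<le> \<bar>\<theta>\<bar> * (mnorm2 C * (mnorm2 J2 * vnorm2 y) + mnorm2 C * (mnorm2 J1 * vnorm2 v)
          + mnorm2 (Ab - C * D * transpose_mat C) * vnorm2 v + mnorm2 (Ab - M) * vnorm2 v)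
      + mnorm2 (B - Cb * transpose_mat Cb) * vnorm2 v + mnorm2 (C * X) * vnorm2 (z - \<theta> \<cdot>\<^sub>v y)
      + mnorm2 (C * X) * (mnorm2 E * vnorm2 v) + mnorm2 E * (mnorm2 Cb * vnorm2 v)"
proof -
  let ?Ct = "transpose_mat C" and ?Xt = "transpose_mat X" and ?Cbt = "transpose_mat Cb" and ?Et = "transpose_mat E"
  have Dc: "D \<in> carrier_mat n n" using D by (simp add: signature_mat_def)
  let ?P = "C * X"
  let ?G = "C * D * ?Ct" and ?H = "Cb * ?Cbt"
  have P: "?P \<in> carrier_mat n r" and E: "E \<in> carrier_mat n r" and Ct: "?Ct \<in> carrier_mat n n"
    and Xt: "?Xt \<in> carrier_mat r n" and Cbt: "?Cbt \<in> carrier_mat r n" and Et: "?Et \<in> carrier_mat r n"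
    and G: "?G \<in> carrier_mat n n" and H: "?H \<in> carrier_mat n n"
    and E0: "Ab - M \<in> carrier_mat n n" and E1: "Ab - ?G \<in> carrier_mat n n" and E2: "B - ?H \<in> carrier_mat n n"
    using C X Cb Dc M by (auto simp: E_def minus_carrier_mat)
  define a1 where "a1 = ?P *\<^sub>v y"
  define a2 where "a2 = C *\<^sub>v (J2 *\<^sub>v y)"
  define a3 where "a3 = C *\<^sub>v (D *\<^sub>v (J1 *\<^sub>v v))"
  define a4 where "a4 = (Ab - ?G) *\<^sub>v v"
  define a5 where "a5 = (Ab - M) *\<^sub>v v"
  define b1 where "b1 = (B - ?H) *\<^sub>v v"
  define b2 where "b2 = ?P *\<^sub>v (z - \<theta> \<cdot>\<^sub>v y)"
  define b3 where "b3 = ?P *\<^sub>v (?Et *\<^sub>v v)"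
  define b4 where "b4 = E *\<^sub>v (?Cbt *\<^sub>v v)"
  have z: "z \<in> carrier_vec r" using Xt Ct v by (simp add: z_def)
  have zy: "z - \<theta> \<cdot>\<^sub>v y \<in> carrier_vec r" using z y by simp
  have car: "a1 \<in> carrier_vec n" "a2 \<in> carrier_vec n" "a3 \<in> carrier_vec n" "a4 \<in> carrier_vec n"
    "a5 \<in> carrier_vec n" "b1 \<in> carrier_vec n" "b2 \<in> carrier_vec n" "b3 \<in> carrier_vec n" "b4 \<in> carrier_vec n"
    using mult_mat_vec_carrier[OF P y] mult_mat_vec_carrier[OF C mult_mat_vec_carrier[OF J(2) y]]
      mult_mat_vec_carrier[OF C mult_mat_vec_carrier[OF Dc mult_mat_vec_carrier[OF J(1) v]]]
      mult_mat_vec_carrier[OF E1 v] mult_mat_vec_carrier[OF E0 v] mult_mat_vec_carrier[OF E2 v]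
      mult_mat_vec_carrier[OF P zy] mult_mat_vec_carrier[OF P mult_mat_vec_carrier[OF Et v]]
      mult_mat_vec_carrier[OF E mult_mat_vec_carrier[OF Cbt v]]
    by (simp_all only: a1_def a2_def a3_def a4_def a5_def b1_def b2_def b3_def b4_def)
  have Gv: "?G *\<^sub>v v = a1 + a2 - a3"
  proof -
    let ?j = "J1 *\<^sub>v v" and ?w = "(X + J2) *\<^sub>v y"
    have j: "?j \<in> carrier_vec n" and w: "?w \<in> carrier_vec n" and t: "?Ct *\<^sub>v v \<in> carrier_vec n"
      using J X y v Ct by (auto intro!: mult_mat_vec_carrier[of _ n r])
    have "?Ct *\<^sub>v v + ?j = D *\<^sub>v ?w" using solve add_mult_distrib_mat_vec[OF Ct J(1) v] by simp
    \<comment> \<open>A second application of \<open>D\<close> undoes the first and isolates (X +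
      J2) y.\<close>
    then have "D *\<^sub>v (?Ct *\<^sub>v v) + D *\<^sub>v ?j = ?w"
      using mult_add_distrib_mat_vec[OF Dc t j] signature_mat_involution[OF D w] by simp
    moreover have "D *\<^sub>v (?Ct *\<^sub>v v) = D *\<^sub>v (?Ct *\<^sub>v v) + D *\<^sub>v ?j - D *\<^sub>v ?j"
    proof -
      have "a = a + b - b" if "a \<in> carrier_vec n" "b \<in> carrier_vec n" for a b :: "real vec"
        using that by (auto intro!: eq_vecI)
      then show ?thesis using mult_mat_vec_carrier[OF Dc t] mult_mat_vec_carrier[OF Dc j] by blast
    qed
    ultimately have Dt: "D *\<^sub>v (?Ct *\<^sub>v v) = (X *\<^sub>v y + J2 *\<^sub>v y) - D *\<^sub>v ?j"
      using add_mult_distrib_mat_vec[OF X J(2) y] by simp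
    have "?G *\<^sub>v v = C *\<^sub>v (D *\<^sub>v (?Ct *\<^sub>v v))"
      using assoc_mult_mat_vec[of "C * D" n n ?Ct n v] C Dc Ct v by simp
    also have "\<dots> = C *\<^sub>v (X *\<^sub>v y + J2 *\<^sub>v y) - a3"
      unfolding Dt a3_def
      using mult_minus_distrib_mat_vec[OF C _ mult_mat_vec_carrier[OF Dc j], of "X *\<^sub>v y + J2 *\<^sub>v y"] X J y by simp
    also have "C *\<^sub>v (X *\<^sub>v y + J2 *\<^sub>v y) = a1 + a2"
      unfolding a1_def a2_def
      using mult_add_distrib_mat_vec[OF C mult_mat_vec_carrier[OF X y] mult_mat_vec_carrier[OF J(2) y]]
        assoc_mult_mat_vec[OF C X y] by simp
    finally show ?thesis .
  qed
  have Mv: "M *\<^sub>v v = a1 + a2 - a3 + a4 - a5"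
  proof -
    have "m = g + (h - g) - (h - m)"
      if "m \<in> carrier_vec n" "g \<in> carrier_vec n" "h \<in> carrier_vec n" for m g h :: "real vec"
      using that by (auto intro!: eq_vecI)
    from this[OF mult_mat_vec_carrier[OF M v] mult_mat_vec_carrier[OF G v] mult_mat_vec_carrier[OF Ab v]]
    show ?thesis
      unfolding a4_def a5_def minus_mult_distrib_mat_vec[OF Ab G v] minus_mult_distrib_mat_vec[OF Ab M v]
      by (simp only: Gv)
  qed
  have Hv: "?H *\<^sub>v v = \<theta> \<cdot>\<^sub>v a1 + b2 - b3 - b4"
  proof -
    let ?s = "?Cbt *\<^sub>v v" and ?e = "?Et *\<^sub>v v"
    have s: "?s \<in> carrier_vec r" and e: "?e \<in> carrier_vec r" using Cbt Et v by simp_all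
    have "?Et = transpose_mat ?P - ?Cbt" unfolding E_def by (rule transpose_minus[OF P Cb])
    also have "transpose_mat ?P = ?Xt * ?Ct" by (rule transpose_mult[OF C X])
    \<comment> \<open>Thus Cb^T v is \<open>z\<close> minus E^T v, that is, \<theta> y up to two
      errors.\<close>
    finally have "?e = z - ?s"
      using minus_mult_distrib_mat_vec[of "?Xt * ?Ct" r n ?Cbt v] Xt Ct Cbt v by (simp add: z_def)
    then have s_eq: "?s = ((z - \<theta> \<cdot>\<^sub>v y) + \<theta> \<cdot>\<^sub>v y) - ?e"
    proof -
      have "s = ((z - t) + t) - (z - s)" if "s \<in> carrier_vec r" "t \<in> carrier_vec r" for s t :: "real vec"
        using that z by (auto intro!: eq_vecI)
      from this[OF s, of "\<theta> \<cdot>\<^sub>v y"] show ?thesis using y \<open>?e = z - ?s\<close> by simp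
    qed
    have ty: "\<theta> \<cdot>\<^sub>v y \<in> carrier_vec r" using y by simp
    have "?P *\<^sub>v ?s = ?P *\<^sub>v ((z - \<theta> \<cdot>\<^sub>v y) + \<theta> \<cdot>\<^sub>v y) - ?P *\<^sub>v ?e"
      unfolding s_eq by (rule mult_minus_distrib_mat_vec[OF P add_carrier_vec[OF zy ty] e])
    also have "?P *\<^sub>v ((z - \<theta> \<cdot>\<^sub>v y) + \<theta> \<cdot>\<^sub>v y) = b2 + \<theta> \<cdot>\<^sub>v a1"
      unfolding a1_def b2_def mult_add_distrib_mat_vec[OF P zy ty] mult_mat_vec[OF P y] ..
    finally have Ps: "?P *\<^sub>v ?s = (b2 + \<theta> \<cdot>\<^sub>v a1) - b3" unfolding b3_def .
    \<comment> \<open>The left factor \<open>Cb\<close> is in turn replaced by C X - E.\<close>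
    have "b4 = ?P *\<^sub>v ?s - Cb *\<^sub>v ?s"
      unfolding b4_def E_def by (rule minus_mult_distrib_mat_vec[OF P Cb s])
    then have "?P *\<^sub>v ?s - b4 = Cb *\<^sub>v ?s"
      using mult_mat_vec_carrier[OF P s] mult_mat_vec_carrier[OF Cb s]
      by (auto intro!: eq_vecI simp del: index_mult_mat_vec assoc_mult_mat_vec)
    also have "\<dots> = ?H *\<^sub>v v" by (rule assoc_mult_mat_vec[OF Cb Cbt v, symmetric])
    finally have "?H *\<^sub>v v = (b2 + \<theta> \<cdot>\<^sub>v a1) - b3 - b4" unfolding Ps by simp
    also have "b2 + \<theta> \<cdot>\<^sub>v a1 = \<theta> \<cdot>\<^sub>v a1 + b2" using car by (intro comm_add_vec) auto
    finally show ?thesis .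
  qed
  have Bv: "B *\<^sub>v v = b1 + (\<theta> \<cdot>\<^sub>v a1 + b2 - b3 - b4)"
  proof -
    have "b = (b - h) + h" if "b \<in> carrier_vec n" "h \<in> carrier_vec n" for b h :: "real vec"
      using that by (auto intro!: eq_vecI)
    from this[OF mult_mat_vec_carrier[OF B v] mult_mat_vec_carrier[OF H v]]
    show ?thesis unfolding b1_def minus_mult_distrib_mat_vec[OF B H v] by (simp only: Hv)
  qed
  have n2: "vnorm2 a2 \<le> mnorm2 C * (mnorm2 J2 * vnorm2 y)"
    unfolding a2_def
    by (rule vnorm2_mult_mat_vec_le_bound[OF C mult_mat_vec_carrier[OF J(2) y] order_refl
          vnorm2_mult_mat_vec_le[OF J(2) y]])
  have n3: "vnorm2 a3 \<le> mnorm2 C * (mnorm2 J1 * vnorm2 v)"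
    unfolding a3_def
    by (rule vnorm2_mult_mat_vec_le_bound[OF C mult_mat_vec_carrier[OF Dc mult_mat_vec_carrier[OF J(1) v]] order_refl])
      (use signature_mat_isometry[OF D mult_mat_vec_carrier[OF J(1) v]] vnorm2_mult_mat_vec_le[OF J(1) v] in simp)
  have nb3: "vnorm2 b3 \<le> mnorm2 ?P * (mnorm2 E * vnorm2 v)"
    unfolding b3_def using vnorm2_mult_mat_vec_le[OF Et v] mnorm2_transpose[OF E]
    by (intro vnorm2_mult_mat_vec_le_bound[OF P mult_mat_vec_carrier[OF Et v]]) auto
  have nb4: "vnorm2 b4 \<le> mnorm2 E * (mnorm2 Cb * vnorm2 v)"
    unfolding b4_def using vnorm2_mult_mat_vec_le[OF Cbt v] mnorm2_transpose[OF Cb]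
    by (intro vnorm2_mult_mat_vec_le_bound[OF E mult_mat_vec_carrier[OF Cbt v]]) auto
  have "vnorm2 (\<theta> \<cdot>\<^sub>v (M *\<^sub>v v) - B *\<^sub>v v)
    \<le> \<bar>\<theta>\<bar> * (vnorm2 a2 + vnorm2 a3 + vnorm2 a4 + vnorm2 a5) + vnorm2 b1 + vnorm2 b2 + vnorm2 b3 + vnorm2 b4"
    unfolding Mv Bv by (rule vnorm2_residual_triangle[OF car])
  also have "\<dots> \<le> \<bar>\<theta>\<bar> * (mnorm2 C * (mnorm2 J2 * vnorm2 y) + mnorm2 C * (mnorm2 J1 * vnorm2 v)
          + mnorm2 (Ab - ?G) * vnorm2 v + mnorm2 (Ab - M) * vnorm2 v)
      + mnorm2 (B - ?H) * vnorm2 v + mnorm2 ?P * vnorm2 (z - \<theta> \<cdot>\<^sub>v y)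
      + mnorm2 ?P * (mnorm2 E * vnorm2 v) + mnorm2 E * (mnorm2 Cb * vnorm2 v)"
    by (intro add_mono mult_left_mono n2 n3 nb3 nb4)
      (auto simp: a4_def a5_def b1_def b2_def simp del: assoc_mult_mat_vec
        intro!: vnorm2_mult_mat_vec_le[OF E1 v] vnorm2_mult_mat_vec_le[OF E0 v]
        vnorm2_mult_mat_vec_le[OF E2 v] vnorm2_mult_mat_vec_le[OF P zy])
  finally show ?thesis .
qed

subsection \<open>The residual bound\<close>

text \<open>As \<open>D\<close> has norm at most 1, X^T D X is bounded by |X|^2, and the error of
  forming it by as much again.\<close>

lemma product_formed_bound:
  assumes pf: "product_formed u r e D X W" and D: "signature_mat n D" and X: "X \<in> carrier_mat n r"
    and ue: "u * e \<le> 1"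
  shows "mnorm2 W \<le> 2 * (mnorm2 X)\<^sup>2"
proof -
  let ?Xt = "transpose_mat X"
  have Dc: "D \<in> carrier_mat n n" using D by (simp add: signature_mat_def)
  have W: "W \<in> carrier_mat r r" and E: "mnorm2 (W - ?Xt * D * X) \<le> u * e * (mnorm2 X)\<^sup>2"
    using pf by (auto simp: product_formed_def)
  have XD: "?Xt * D \<in> carrier_mat r n" using X Dc by simp
  have G: "?Xt * D * X \<in> carrier_mat r r" using X Dc by simp
  have "mnorm2 (?Xt * D * X) \<le> mnorm2 ?Xt * mnorm2 D * mnorm2 X"
    using mnorm2_mult_le[OF XD X] mnorm2_mult_le[of ?Xt r n D n] X Dc
    by (meson mnorm2_nonneg mult_right_mono order_trans transpose_carrier_mat)
  also have "\<dots> \<le> mnorm2 ?Xt * 1 * mnorm2 X"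
    using mnorm2_signature_le[OF D] by (intro mult_right_mono mult_left_mono) auto
  also have "\<dots> = (mnorm2 X)\<^sup>2" using mnorm2_transpose[OF X] by (simp add: power2_eq_square)
  finally have Gn: "mnorm2 (?Xt * D * X) \<le> (mnorm2 X)\<^sup>2" .
  have "W = ?Xt * D * X + (W - ?Xt * D * X)"
    using W G by (intro eq_matI) (auto simp del: assoc_mult_mat index_mult_mat(1))
  then have "mnorm2 W \<le> mnorm2 (?Xt * D * X) + mnorm2 (W - ?Xt * D * X)"
    using mnorm2_add_le[OF G minus_carrier_mat[OF G]] by metis
  moreover have "u * e * (mnorm2 X)\<^sup>2 \<le> 1 * (mnorm2 X)\<^sup>2" using ue by (intro mult_right_mono) auto
  ultimately show ?thesis using Gn E by linarith
qed

text \<open>s B is the difference of \<open>A\<close> and A - s B. The proof solves for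
  \<open>B\<close> because \<open>mnorm2_smult_le\<close> bounds scaled matrices from above
  only.\<close>

lemma shift_norm_le:
  assumes A: "A \<in> carrier_mat n n" and B: "B \<in> carrier_mat n n"
  shows "\<bar>s\<bar> * mnorm2 B \<le> mnorm2 A + mnorm2 (A - s \<cdot>\<^sub>m B)"
proof (cases "s = 0")
  case False
  have "B = (1 / s) \<cdot>\<^sub>m (A - (A - s \<cdot>\<^sub>m B))" using A B False by (auto intro!: eq_matI)
  then have "mnorm2 B \<le> \<bar>1 / s\<bar> * mnorm2 (A - (A - s \<cdot>\<^sub>m B))"
    using mnorm2_smult_le[of "A - (A - s \<cdot>\<^sub>m B)" n n "1 / s"] A B by (simp add: minus_carrier_mat)
  also have "\<dots> \<le> \<bar>1 / s\<bar> * (mnorm2 A + mnorm2 (A - s \<cdot>\<^sub>m B))"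
    using mnorm2_diff_le[OF A, of "A - s \<cdot>\<^sub>m B"] A B
    by (intro mult_left_mono) (auto simp: minus_carrier_mat)
  finally show ?thesis using False by (simp add: field_simps)
qed simp

text \<open>|s| |B| is at most twice the maximum, so 2 * 2 + 1 = 5. Eliminating |s| |B| in this way
  is what brings max(\<gamma>, 1) into the final bound.\<close>

lemma fl_shifted_error_max:
  assumes fl: "fl_shifted u n A B s Ab" and A: "A \<in> carrier_mat n n" and B: "B \<in> carrier_mat n n"
    and u: "0 \<le> u" "u \<le> 1"
  shows "mnorm2 (Ab - (A - s \<cdot>\<^sub>m B)) \<le> u * (5 * n * max (mnorm2 A) (mnorm2 (A - s \<cdot>\<^sub>m B)))"
proof -
  let ?\<mu> = "mnorm2 (A - s \<cdot>\<^sub>m B)"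
  have "2 * (\<bar>s\<bar> * mnorm2 B) + ?\<mu> \<le> 5 * max (mnorm2 A) ?\<mu>"
    using shift_norm_le[OF A B, of s] by simp
  then have "n * (u * (2 * (\<bar>s\<bar> * mnorm2 B) + ?\<mu>)) \<le> n * (u * (5 * max (mnorm2 A) ?\<mu>))"
    using u by (intro mult_left_mono) auto
  also have "\<dots> = u * (5 * n * max (mnorm2 A) ?\<mu>)" by (simp only: mult_ac)
  finally show ?thesis using fl_shifted_error[OF fl A B u] by linarith
qed

text \<open>Sources of the summands: \<open>b q\<close> from \<open>J2\<close>, \<open>b p\<close> and \<open>b\<^sup>2 p\<close> from \<open>J1\<close>, \<open>b d\<close>
from \<open>C X - Cb\<close>, \<open>a\<close> from the factorization, \<open>n\<close> from forming the shifted matrix, and the last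
one from the eigenvector residual.\<close>

definition residual_const :: "nat \<Rightarrow> real \<Rightarrow> real \<Rightarrow> real \<Rightarrow> real \<Rightarrow> real \<Rightarrow> real \<Rightarrow> real \<Rightarrow> real \<Rightarrow> real" where
  "residual_const n a b d e f g p q = 16 * b * q + 6 * b * p + 10 * b * d + 8 * b\<^sup>2 * p + 8 * a
     + 20 * real n + 48 * (16 * g + 2 * f + e + q)"

text \<open>Here \<open>u\<close> is restricted by explicit inequalities, which absorb the
  second-order products. Among the terms with a factor |\<theta>|, those in \<open>v\<close> use
  |\<theta>| \<le> 4 x^2, while the one in \<open>y\<close> is traded for \<open>v\<close> by means
  of \<open>thY\<close>.\<close>

lemma residual_bound:
  fixes \<theta> \<sigma> u :: real
  assumes A: "A \<in> carrier_mat n n" and B: "B \<in> carrier_mat n n" and \<sigma>: "\<sigma> \<noteq> 0" and \<theta>0: "\<theta> \<noteq> 0"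
    and pos: "0 < a" "0 < b" "0 < d" "0 < e" "0 < f" "0 < g" "0 < p" "0 < q"
    and fl: "fl_shifted u n A B \<sigma> Ab" and sf: "shifted_factor u n a b Ab C D"
    and sd: "semidef_factor u n r c B Cb" and fs: "factor_solve u n r d C Cb X"
    and pf: "product_formed u r e D X W" and eig: "eig_decomposed u r f g W U \<Theta>"
    and i: "i < r" and \<theta>: "\<theta> = \<Theta> $$ (i,i)"
    and rec: "stable_recovery u n r p q C D X (col U i) v"
  defines "M \<equiv> A - \<sigma> \<cdot>\<^sub>m B" and "\<beta> \<equiv> mnorm2 B" and "x \<equiv> mnorm2 X" and "\<kappa> \<equiv> 16 * g + 2 * f + e + q"
  defines "\<mu> \<equiv> mnorm2 M" and "G \<equiv> max (mnorm2 A) (mnorm2 M)"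
  assumes u: "0 < u" "u \<le> 1"
    and small: "u * (5 * n * G) \<le> \<mu>" "u * c \<le> 1" "u * e \<le> 1" "u * f \<le> 1" "u * (2 * g) \<le> 1"
      "u * (d * mnorm2 C * x) \<le> sqrt \<beta>" "u * (\<kappa> * x\<^sup>2) \<le> \<bar>\<theta>\<bar> / 2" "u * (p * mnorm2 C * x) \<le> sqrt \<beta>"
  shows "vnorm2 (\<theta> \<cdot>\<^sub>v (M *\<^sub>v v) - B *\<^sub>v v)
    \<le> (u * c * \<beta> + residual_const n a b d e f g p q * u *
        (sqrt \<mu> * sqrt \<beta> * x + (\<mu> + G * (1 + 1 / \<bar>\<theta> * \<sigma>\<bar>)) * x\<^sup>2)) * vnorm2 v"
proof -
  have M: "M \<in> carrier_mat n n" using A B by (simp add: M_def minus_carrier_mat)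
  have Ab: "Ab \<in> carrier_mat n n" using fl by (simp add: fl_shifted_def)
  have C: "C \<in> carrier_mat n n" using sf by (simp add: shifted_factor_def)
  have Cb: "Cb \<in> carrier_mat n r" using sd by (simp add: semidef_factor_def)
  have X: "X \<in> carrier_mat n r" using fs by (simp add: factor_solve_def)
  have W: "W \<in> carrier_mat r r" using pf by (simp add: product_formed_def)
  have U: "U \<in> carrier_mat r r" using eig by (simp add: eig_decomposed_def)
  define y where "y = col U i"
  have y: "y \<in> carrier_vec r" using U by (auto simp: y_def intro!: carrier_vecI)
  obtain J1 J2 where v: "v \<in> carrier_vec n" and J: "J1 \<in> carrier_mat n n" "J2 \<in> carrier_mat n r"
    and solve: "(transpose_mat C + J1) *\<^sub>v v = D *\<^sub>v ((X + J2) *\<^sub>v y)"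
    and J1n: "mnorm2 J1 \<le> u * p * mnorm2 C" and J2n: "mnorm2 J2 \<le> u * q * mnorm2 X"
    using rec unfolding stable_recovery_def y_def by blast
  define \<nu> Y k where "\<nu> = vnorm2 v" and "Y = vnorm2 y" and "k = mnorm2 C"
  have nn: "0 \<le> \<beta>" "0 \<le> x" "0 \<le> \<mu>" "0 \<le> \<nu>" "0 \<le> Y" "0 \<le> k" "0 \<le> G" "0 < \<kappa>"
    using pos by (simp_all add: \<beta>_def x_def \<mu>_def \<nu>_def Y_def k_def G_def \<kappa>_def le_max_iff_disj)
  have \<sigma>\<beta>: "\<bar>\<sigma>\<bar> * \<beta> \<le> 2 * G"
    using shift_norm_le[OF A B, of \<sigma>] by (simp add: \<beta>_def G_def M_def)
  have E0: "mnorm2 (Ab - M) \<le> u * (5 * n * G)"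
    using fl_shifted_error_max[OF fl A B _ u(2)] u by (simp add: M_def G_def)
  have close: "mnorm2 (Ab - M) \<le> mnorm2 M" using E0 small(1) by (simp add: \<mu>_def)
  have b0: "0 \<le> b" and ua: "0 \<le> u * a" using pos u by simp_all
  note C_bounds = shifted_factor_bounds[OF sf Ab M close b0 ua, folded \<mu>_def k_def]
  note D = C_bounds(1)
  have Cbn: "mnorm2 Cb \<le> 2 * sqrt \<beta>"
    using semidef_factor_bound[OF sd B small(2)] by (simp add: \<beta>_def)
  define \<epsilon> where "\<epsilon> = u * (d * k * x)"
  have E3: "mnorm2 (C * X - Cb) \<le> \<epsilon>"
    using fs by (simp add: factor_solve_def \<epsilon>_def k_def x_def mult_ac)
  have \<epsilon>0: "0 \<le> \<epsilon>" using E3 mnorm2_nonneg order_trans by blast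
  define P where "P = C * X"
  have P: "P \<in> carrier_mat n r" using C X by (simp add: P_def)
  \<comment> \<open>2 for \<open>Cb\<close> and 1 for the absorbed error of the solve.\<close>
  have Pn: "mnorm2 P \<le> 3 * sqrt \<beta>"
    using factor_solve_bound[OF fs C Cb] Cbn small(6) by (simp add: P_def x_def mult_ac)
  have Wn: "mnorm2 W \<le> 2 * x\<^sup>2" using product_formed_bound[OF pf D X small(3)] by (simp add: x_def)
  note ev = eig_decomposed_column[OF eig W i _ small(4), folded \<theta> y_def Y_def]
  have th: "\<bar>\<theta>\<bar> \<le> 4 * x\<^sup>2" using ev(1) u small(5) Wn by simp
  have Wy: "vnorm2 (W *\<^sub>v y - \<theta> \<cdot>\<^sub>v y) \<le> (u * (8 * g + f) * (2 * x\<^sup>2)) * vnorm2 y"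
  proof -
    have "vnorm2 (W *\<^sub>v y - \<theta> \<cdot>\<^sub>v y) \<le> u * (8 * g + f) * mnorm2 W * Y"
      using ev(3) u small(5) by simp
    also have "\<dots> \<le> u * (8 * g + f) * (2 * x\<^sup>2) * Y"
      using Wn u pos nn by (intro mult_right_mono mult_left_mono) auto
    finally show ?thesis by (simp add: Y_def)
  qed
  define z where "z = transpose_mat X *\<^sub>v (transpose_mat C *\<^sub>v v)"
  define \<rho> where "\<rho> = vnorm2 (z - \<theta> \<cdot>\<^sub>v y)"
  \<comment> \<open>In \<kappa> the coefficients 8 g + f are doubled because |W| \<le> 2 x^2;
    \<open>e\<close> and \<open>q\<close> multiply x^2 directly.\<close>
  have \<rho>: "\<rho> \<le> u * (\<kappa> * x\<^sup>2) * Y + u * (p * k * x) * \<nu>"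
    using transformed_solve_residual[OF C D X pf J y v solve J1n J2n Wy]
    by (simp add: \<rho>_def z_def \<kappa>_def k_def x_def Y_def \<nu>_def algebra_simps)
  have z: "z \<in> carrier_vec r" and zn: "vnorm2 z \<le> 3 * sqrt \<beta> * \<nu>"
  proof -
    have Xt: "transpose_mat X \<in> carrier_mat r n" and Ct: "transpose_mat C \<in> carrier_mat n n"
      using X C by simp_all
    have zP: "z = transpose_mat P *\<^sub>v v"
      unfolding P_def transpose_mult[OF C X] z_def by (rule assoc_mult_mat_vec[OF Xt Ct v, symmetric])
    have Pt: "transpose_mat P \<in> carrier_mat r n" using P by simp
    show "z \<in> carrier_vec r" unfolding zP by (rule mult_mat_vec_carrier[OF Pt v])
    show "vnorm2 z \<le> 3 * sqrt \<beta> * \<nu>"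
      unfolding zP \<nu>_def using Pn mnorm2_transpose[OF P]
      by (intro vnorm2_mult_mat_vec_le_bound[OF Pt v]) auto
  qed
  \<comment> \<open>\<theta> y equals \<open>z\<close> up to \<rho>. The part of \<rho> in
    \<open>y\<close> is at most half of the left side and is moved there; what remains, 3 + 1, is
    doubled.\<close>
  have thY: "\<bar>\<theta>\<bar> * Y \<le> 8 * sqrt \<beta> * \<nu>"
  proof -
    have "\<theta> \<cdot>\<^sub>v y = z - (z - \<theta> \<cdot>\<^sub>v y)" using z y by (auto intro!: eq_vecI)
    then have "\<bar>\<theta>\<bar> * Y \<le> vnorm2 z + \<rho>"
      using vnorm2_diff_le[OF z, of "z - \<theta> \<cdot>\<^sub>v y"] z y vnorm2_smult[of \<theta> y]
      by (simp add: Y_def \<rho>_def)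
    moreover have "u * (\<kappa> * x\<^sup>2) * Y \<le> \<bar>\<theta>\<bar> / 2 * Y" by (rule mult_right_mono[OF small(7) nn(5)])
    moreover have "u * (p * k * x) * \<nu> \<le> sqrt \<beta> * \<nu>"
      unfolding k_def by (rule mult_right_mono[OF small(8) nn(4)])
    ultimately have "\<bar>\<theta>\<bar> * Y \<le> 4 * sqrt \<beta> * \<nu> + \<bar>\<theta>\<bar> / 2 * Y" using zn \<rho> by linarith
    then show ?thesis by simp
  qed
  define \<xi> where "\<xi> = sqrt \<mu> * sqrt \<beta> * x"
  have \<xi>0: "0 \<le> \<xi>" using nn by (simp add: \<xi>_def)
  have t2: "\<bar>\<theta>\<bar> * (k * (mnorm2 J2 * Y)) \<le> u * (16 * b * q) * \<xi> * \<nu>"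
  proof -
    have "\<bar>\<theta>\<bar> * (k * (mnorm2 J2 * Y)) = k * mnorm2 J2 * (\<bar>\<theta>\<bar> * Y)" by simp
    also have "\<dots> \<le> (2 * b * sqrt \<mu>) * (u * q * x) * (8 * sqrt \<beta> * \<nu>)"
      by (intro mult_mono[OF mult_mono[OF C_bounds(4) J2n[folded x_def]] thY]) (use u nn pos in auto)
    finally show ?thesis by (simp add: \<xi>_def mult_ac)
  qed
  have t3: "\<bar>\<theta>\<bar> * (k * (mnorm2 J1 * \<nu>)) \<le> u * (8 * b\<^sup>2 * p) * (\<mu> * x\<^sup>2) * \<nu>"
  proof -
    have "k * mnorm2 J1 \<le> k * (u * p * k)" using J1n nn by (intro mult_left_mono) (auto simp: k_def)
    also have "\<dots> = u * p * k\<^sup>2" by (simp add: power2_eq_square)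
    also have "\<dots> \<le> u * p * (2 * b\<^sup>2 * \<mu>)" using C_bounds(3) u pos by (intro mult_left_mono) auto
    finally have "k * mnorm2 J1 \<le> u * p * (2 * b\<^sup>2 * \<mu>)" .
    from mult_right_mono[OF mult_mono[OF th this] nn(4)]
    have "\<bar>\<theta>\<bar> * (k * mnorm2 J1) * \<nu> \<le> (4 * x\<^sup>2) * (u * p * (2 * b\<^sup>2 * \<mu>)) * \<nu>"
      using nn by simp
    then show ?thesis by (simp add: mult_ac)
  qed
  have t4: "\<bar>\<theta>\<bar> * (mnorm2 (Ab - C * D * transpose_mat C) * \<nu>) \<le> u * (8 * a) * (\<mu> * x\<^sup>2) * \<nu>"
  proof -
    have "\<bar>\<theta>\<bar> * mnorm2 (Ab - C * D * transpose_mat C) * \<nu> \<le> (4 * x\<^sup>2) * (2 * (u * a) * \<mu>) * \<nu>"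
      by (intro mult_right_mono[OF mult_mono[OF th C_bounds(2)] nn(4)]) auto
    then show ?thesis by (simp add: mult_ac)
  qed
  have t5: "\<bar>\<theta>\<bar> * (mnorm2 (Ab - M) * \<nu>) \<le> u * (20 * n) * (G * x\<^sup>2) * \<nu>"
  proof -
    have "\<bar>\<theta>\<bar> * mnorm2 (Ab - M) * \<nu> \<le> (4 * x\<^sup>2) * (u * (5 * n * G)) * \<nu>"
      by (intro mult_right_mono[OF mult_mono[OF th E0] nn(4)]) auto
    then show ?thesis by (simp add: mult_ac)
  qed
  have s1: "mnorm2 (B - Cb * transpose_mat Cb) * \<nu> \<le> u * c * \<beta> * \<nu>"
    using sd nn by (intro mult_right_mono) (auto simp: semidef_factor_def \<beta>_def)
  have Ysolve: "Y \<le> 8 * sqrt \<beta> * \<nu> / \<bar>\<theta>\<bar>" using thY \<theta>0 by (simp add: field_simps)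
  \<comment> \<open>The \<kappa> part contains |y| without a factor |\<theta>|, so
    \<open>thY\<close> has to be divided by |\<theta>|. The resulting \<beta> / |\<theta>| is at
    most 2 G / |\<theta> \<sigma>|, and 3 * 8 * 2 = 48.\<close>
  have s2: "mnorm2 P * \<rho> \<le> u * (48 * \<kappa>) * (G * (1 / \<bar>\<theta> * \<sigma>\<bar>) * x\<^sup>2) * \<nu> + u * (6 * b * p) * \<xi> * \<nu>"
  proof -
    have "mnorm2 P * \<rho> \<le> 3 * sqrt \<beta> * (u * (\<kappa> * x\<^sup>2) * Y + u * (p * k * x) * \<nu>)"
      by (intro mult_mono[OF Pn \<rho>]) (use nn in \<open>auto simp: \<rho>_def\<close>)
    moreover have "3 * sqrt \<beta> * (u * (\<kappa> * x\<^sup>2) * Y) \<le> u * (48 * \<kappa>) * (G * (1 / \<bar>\<theta> * \<sigma>\<bar>) * x\<^sup>2) * \<nu>"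
    proof -
      have "\<beta> \<le> 2 * G / \<bar>\<sigma>\<bar>" using \<sigma>\<beta> \<sigma> by (simp add: field_simps)
      then have \<beta>\<theta>: "\<beta> / \<bar>\<theta>\<bar> \<le> 2 * (G * (1 / \<bar>\<theta> * \<sigma>\<bar>))"
        using \<theta>0 by (simp add: abs_mult field_simps)
      have "3 * sqrt \<beta> * (u * (\<kappa> * x\<^sup>2) * Y) \<le> 3 * sqrt \<beta> * (u * (\<kappa> * x\<^sup>2) * (8 * sqrt \<beta> * \<nu> / \<bar>\<theta>\<bar>))"
        using Ysolve u nn by (intro mult_left_mono) auto
      also have "\<dots> = u * (24 * \<kappa>) * x\<^sup>2 * \<nu> * ((sqrt \<beta> * sqrt \<beta>) / \<bar>\<theta>\<bar>)"
        by (simp add: mult_ac)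
      also have "\<dots> = u * (24 * \<kappa>) * x\<^sup>2 * \<nu> * (\<beta> / \<bar>\<theta>\<bar>)" using nn by simp
      also have "\<dots> \<le> u * (24 * \<kappa>) * x\<^sup>2 * \<nu> * (2 * (G * (1 / \<bar>\<theta> * \<sigma>\<bar>)))"
        using \<beta>\<theta> u nn by (intro mult_left_mono) auto
      finally show ?thesis by (simp add: mult_ac)
    qed
    moreover have "3 * sqrt \<beta> * (u * (p * k * x) * \<nu>) \<le> u * (6 * b * p) * \<xi> * \<nu>"
    proof -
      have "3 * sqrt \<beta> * (u * (p * k * x) * \<nu>) \<le> 3 * sqrt \<beta> * (u * (p * (2 * b * sqrt \<mu>) * x) * \<nu>)"
        using C_bounds(4) u nn pos by (intro mult_left_mono mult_right_mono) auto
      then show ?thesis by (simp add: \<xi>_def mult_ac)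
    qed
    ultimately show ?thesis by (simp only: distrib_left)
  qed
  \<comment> \<open>Both uses of the solve error reduce to this product, with factor 3 from |C X|
    and 2 from |Cb|; hence 10 b d.\<close>
  have \<epsilon>\<xi>: "sqrt \<beta> * \<epsilon> * \<nu> \<le> u * (2 * b * d) * \<xi> * \<nu>"
  proof -
    have "sqrt \<beta> * \<epsilon> * \<nu> \<le> sqrt \<beta> * (u * (d * (2 * b * sqrt \<mu>) * x)) * \<nu>"
      unfolding \<epsilon>_def using C_bounds(4) u nn pos by (intro mult_left_mono mult_right_mono) auto
    then show ?thesis by (simp add: \<xi>_def mult_ac)
  qed
  have s3: "mnorm2 P * (mnorm2 (C * X - Cb) * \<nu>) \<le> 3 * (sqrt \<beta> * \<epsilon> * \<nu>)"
  proof -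
    have "mnorm2 P * (mnorm2 (C * X - Cb) * \<nu>) \<le> 3 * sqrt \<beta> * (\<epsilon> * \<nu>)"
      by (intro mult_mono[OF Pn mult_right_mono[OF E3 nn(4)]]) (use nn in auto)
    then show ?thesis by (simp add: mult_ac)
  qed
  have s4: "mnorm2 (C * X - Cb) * (mnorm2 Cb * \<nu>) \<le> 2 * (sqrt \<beta> * \<epsilon> * \<nu>)"
  proof -
    have "mnorm2 (C * X - Cb) * (mnorm2 Cb * \<nu>) \<le> \<epsilon> * (2 * sqrt \<beta> * \<nu>)"
      by (intro mult_mono[OF E3 mult_right_mono[OF Cbn nn(4)]]) (use nn \<epsilon>0 in auto)
    then show ?thesis by (simp add: mult_ac)
  qed
  \<comment> \<open>Each first-order summand apart from the \<open>c\<close> term is a constant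
    times one of the four parts of this total, so the constants simply add up.\<close>
  define T where "T = \<xi> + (\<mu> + G * (1 + 1 / \<bar>\<theta> * \<sigma>\<bar>)) * x\<^sup>2"
  have R0: "0 \<le> 1 / \<bar>\<theta> * \<sigma>\<bar>" by simp
  have T_expand: "T = \<xi> + \<mu> * x\<^sup>2 + G * x\<^sup>2 + G * (1 / \<bar>\<theta> * \<sigma>\<bar>) * x\<^sup>2"
    by (simp add: T_def algebra_simps)
  have nonneg4: "0 \<le> \<mu> * x\<^sup>2" "0 \<le> G * x\<^sup>2" "0 \<le> G * (1 / \<bar>\<theta> * \<sigma>\<bar>) * x\<^sup>2"
    using nn R0 by simp_all
  have le_T: "\<xi> \<le> T" "\<mu> * x\<^sup>2 \<le> T" "G * x\<^sup>2 \<le> T" "G * (1 / \<bar>\<theta> * \<sigma>\<bar>) * x\<^sup>2 \<le> T"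
    using nonneg4 \<xi>0 unfolding T_expand by linarith+
  have up: "u * w * s * \<nu> \<le> w * (u * T * \<nu>)" if "0 \<le> w" "s \<le> T" for w s
  proof -
    have "u * w * \<nu> * s \<le> u * w * \<nu> * T" using that u nn by (intro mult_left_mono) auto
    then show ?thesis by (simp add: mult_ac)
  qed
  have "vnorm2 (\<theta> \<cdot>\<^sub>v (M *\<^sub>v v) - B *\<^sub>v v)
    \<le> \<bar>\<theta>\<bar> * (k * (mnorm2 J2 * Y) + k * (mnorm2 J1 * \<nu>)
          + mnorm2 (Ab - C * D * transpose_mat C) * \<nu> + mnorm2 (Ab - M) * \<nu>)
      + mnorm2 (B - Cb * transpose_mat Cb) * \<nu> + mnorm2 P * \<rho>
      + mnorm2 P * (mnorm2 (C * X - Cb) * \<nu>) + mnorm2 (C * X - Cb) * (mnorm2 Cb * \<nu>)"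
    using residual_decomposition[OF M B Ab C D Cb X J y v solve, of \<theta>]
    unfolding k_def Y_def \<nu>_def P_def \<rho>_def z_def .
  also have "\<dots> \<le> u * c * \<beta> * \<nu> + residual_const n a b d e f g p q * (u * T * \<nu>)"
  proof -
    define S where "S = u * T * \<nu>"
    have "\<bar>\<theta>\<bar> * (k * (mnorm2 J2 * Y)) \<le> 16 * b * q * S"
      "\<bar>\<theta>\<bar> * (k * (mnorm2 J1 * \<nu>)) \<le> 8 * b\<^sup>2 * p * S"
      "\<bar>\<theta>\<bar> * (mnorm2 (Ab - C * D * transpose_mat C) * \<nu>) \<le> 8 * a * S"
      "\<bar>\<theta>\<bar> * (mnorm2 (Ab - M) * \<nu>) \<le> 20 * n * S"
      "mnorm2 P * \<rho> \<le> 48 * \<kappa> * S + 6 * b * p * S"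
      "sqrt \<beta> * \<epsilon> * \<nu> \<le> 2 * b * d * S"
      unfolding S_def using pos nn le_T
      by (intro order_trans[OF t2] order_trans[OF t3] order_trans[OF t4] order_trans[OF t5]
          order_trans[OF s2] order_trans[OF \<epsilon>\<xi>] add_mono up; simp)+
    note bounds = this
    have "\<bar>\<theta>\<bar> * (k * (mnorm2 J2 * Y) + k * (mnorm2 J1 * \<nu>)
          + mnorm2 (Ab - C * D * transpose_mat C) * \<nu> + mnorm2 (Ab - M) * \<nu>)
        \<le> 16 * b * q * S + 8 * b\<^sup>2 * p * S + 8 * a * S + 20 * n * S"
      unfolding distrib_left using bounds by linarith
    moreover have "residual_const n a b d e f g p q * S = 16 * b * q * S + 8 * b\<^sup>2 * p * S + 8 * a * S + 20 * n * S
        + (48 * \<kappa> * S + 6 * b * p * S) + 5 * (2 * b * d * S)"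
      by (simp add: residual_const_def \<kappa>_def algebra_simps)
    ultimately show ?thesis using bounds s1 s3 s4 unfolding S_def[symmetric] by linarith
  qed
  also have "\<dots> = (u * c * \<beta> + residual_const n a b d e f g p q * u * T) * \<nu>" by (simp add: algebra_simps)
  finally show ?thesis by (simp add: T_def \<xi>_def \<nu>_def)
qed

text \<open>With M = A - \<sigma> B, multiplication by |B| clears the quotients: \<eta> |B| is the
  root of |M| |B|, and \<eta>^2 |B| = |M|. The |M| gained in this way turns max(\<gamma>, 1) into
  the maximum of |A| and |M|.\<close>

lemma bracket_mult_mnorm2:
  fixes \<theta> \<sigma> :: real
  assumes \<sigma>: "\<sigma> \<noteq> 0" and \<theta>: "\<theta> \<noteq> 0" and l: "l = (1 + \<sigma> * \<theta>) / \<theta>"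
    and B: "0 < mnorm2 B" and M: "0 < mnorm2 (A - \<sigma> \<cdot>\<^sub>m B)"
  shows "bracket A B \<sigma> u c hu l x * mnorm2 B
    = u * c * mnorm2 B + hu * (sqrt (mnorm2 (A - \<sigma> \<cdot>\<^sub>m B)) * sqrt (mnorm2 B) * x
        + (mnorm2 (A - \<sigma> \<cdot>\<^sub>m B)
           + max (mnorm2 A) (mnorm2 (A - \<sigma> \<cdot>\<^sub>m B)) * (1 + 1 / \<bar>\<theta> * \<sigma>\<bar>)) * x\<^sup>2)"
proof -
  define \<mu> \<beta> where "\<mu> = mnorm2 (A - \<sigma> \<cdot>\<^sub>m B)" and "\<beta> = mnorm2 B"
  have pos: "0 < \<mu>" "0 < \<beta>" using B M by (simp_all add: \<mu>_def \<beta>_def)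
  have "1 - l / \<sigma> = - 1 / (\<theta> * \<sigma>)" using \<sigma> \<theta> by (simp add: l field_simps)
  then have l1: "\<bar>1 - l / \<sigma>\<bar> = 1 / \<bar>\<theta> * \<sigma>\<bar>" by (simp add: abs_divide)
  have eta1: "eta A B \<sigma> * \<beta> = sqrt \<mu> * sqrt \<beta>"
    using pos by (simp add: eta_def \<mu>_def[symmetric] \<beta>_def[symmetric] field_simps)
  have eta2: "(eta A B \<sigma>)\<^sup>2 * \<beta> = \<mu>"
    using pos by (simp add: eta_def \<mu>_def[symmetric] \<beta>_def[symmetric] power_divide)
  have gam1: "max (gam A B \<sigma>) 1 * \<mu> = max (mnorm2 A) \<mu>"
    using pos max_mult_distrib_right[of "gam A B \<sigma>" 1 \<mu>]
    by (simp add: gam_def \<mu>_def[symmetric] field_simps)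
  have "bracket A B \<sigma> u c hu l x * \<beta> = u * c * \<beta> + hu * ((eta A B \<sigma> * \<beta>) * x
      + (((eta A B \<sigma>)\<^sup>2 * \<beta>) + max (gam A B \<sigma>) 1 * ((eta A B \<sigma>)\<^sup>2 * \<beta>) * (1 + \<bar>1 - l / \<sigma>\<bar>)) * x\<^sup>2)"
    by (simp add: bracket_def algebra_simps)
  then show ?thesis unfolding eta1 eta2 gam1 l1 by (simp only: \<mu>_def \<beta>_def)
qed

section \<open>A threshold for \<open>u\<close> uniform in the computed quantities\<close>

lemma residual_const_pos:
  assumes "0 < a" "0 < b" "0 < d" "0 < e" "0 < f" "0 < g" "0 < p" "0 < q"
  shows "0 < residual_const n a b d e f g p q"
  unfolding residual_const_def by (intro add_nonneg_pos add_nonneg_nonneg) (use assms in auto)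

text \<open>A pair \<open>(k, t)\<close> encodes the condition u k \<le> t. Each has a positive
  threshold and finitely many thresholds have a positive minimum, so all smallness conditions can be
  kept in one list.\<close>

lemma common_smallness:
  fixes S :: "(real \<times> real) set"
  assumes "finite S" "\<And>k t. (k, t) \<in> S \<Longrightarrow> 0 < t"
  obtains u0 where "0 < u0" "\<And>u k t. 0 < u \<Longrightarrow> u \<le> u0 \<Longrightarrow> (k, t) \<in> S \<Longrightarrow> u * k \<le> t"
proof -
  have "\<exists>u0>0. \<forall>u. 0 < u \<and> u \<le> u0 \<longrightarrow> (\<forall>(k, t) \<in> S. u * k \<le> t)"
    using assms
  proof (induction S rule: finite_induct)
    case empty
    show ?case by (auto intro: exI[of _ 1])
  next
    case (insert kt S)
    obtain k t where kt: "kt = (k, t)" by (cases kt)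
    obtain u1 where u1: "0 < u1" "\<And>u. 0 < u \<Longrightarrow> u \<le> u1 \<Longrightarrow> \<forall>(k, t) \<in> S. u * k \<le> t"
      using insert by (metis insertCI)
    have t: "0 < t" using insert.prems kt by auto
    \<comment> \<open>\<open>\<bar>k\<bar> + 1\<close> is a positive divisor for \<open>k\<close> of
      any sign.\<close>
    have "u * k \<le> t" if "0 < u" "u \<le> t / (\<bar>k\<bar> + 1)" for u
    proof -
      have "u * (\<bar>k\<bar> + 1) \<le> t" using that(2) by (simp add: pos_le_divide_eq add_nonneg_pos)
      moreover have "u * k \<le> u * (\<bar>k\<bar> + 1)" using that(1) by (intro mult_left_mono) auto
      ultimately show ?thesis by linarith
    qed
    then show ?case using u1 t kt
      by (intro exI[of _ "min u1 (t / (\<bar>k\<bar> + 1))"]) (auto simp: add_nonneg_pos)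
  qed
  then obtain u0 where u0: "0 < u0" "\<forall>u. 0 < u \<and> u \<le> u0 \<longrightarrow> (\<forall>(k, t) \<in> S. u * k \<le> t)" by blast
  show ?thesis by (rule that[OF u0(1)]) (use u0(2) in blast)
qed

text \<open>The threshold must be fixed before \<open>r\<close> and the computed quantities are
  known. Conditions on |C|, |X| and |\<theta>| are therefore replaced by conditions on a priori
  bounds \<open>k\<close>, \<open>x0\<close> and \<tau>.\<close>

lemma residual_bound_uniform:
  fixes \<sigma> \<tau> :: real
  assumes A: "A \<in> carrier_mat n n" and B: "B \<in> carrier_mat n n"
    and A0: "A \<noteq> 0\<^sub>m n n" and B0: "B \<noteq> 0\<^sub>m n n" and \<sigma>: "\<sigma> \<noteq> 0"
    and inv: "invertible_mat (A - \<sigma> \<cdot>\<^sub>m B)" and \<tau>: "0 < \<tau>"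
    and pos: "0 < a" "0 < b" "0 < d" "0 < e" "0 < f" "0 < g" "0 < p" "0 < q"
  obtains u0 where "0 < u0"
    "\<And>u r Ab C D Cb X W U \<Theta> i v \<theta> l. \<lbrakk>0 < u; u \<le> u0; fl_shifted u n A B \<sigma> Ab;
      shifted_factor u n a b Ab C D; semidef_factor u n r c B Cb; factor_solve u n r d C Cb X;
      product_formed u r e D X W; eig_decomposed u r f g W U \<Theta>; i < r; \<theta> = \<Theta> $$ (i,i);
      \<tau> \<le> \<bar>\<theta>\<bar>; l = (1 + \<sigma> * \<theta>) / \<theta>; stable_recovery u n r p q C D X (col U i) v\<rbrakk>
     \<Longrightarrow> vnorm2 (\<theta> \<cdot>\<^sub>v ((A - \<sigma> \<cdot>\<^sub>m B) *\<^sub>v v) - B *\<^sub>v v)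
       \<le> bracket A B \<sigma> u c (residual_const n a b d e f g p q * u) l (mnorm2 X) * mnorm2 B * vnorm2 v"
proof -
  define M where "M = A - \<sigma> \<cdot>\<^sub>m B"
  define \<beta> \<mu> G where "\<beta> = mnorm2 B" and "\<mu> = mnorm2 M" and "G = max (mnorm2 A) (mnorm2 M)"
  have M: "M \<in> carrier_mat n n" using A B by (simp add: M_def minus_carrier_mat)
  have \<beta>: "0 < \<beta>" using mnorm2_pos[OF B B0] by (simp add: \<beta>_def)
  obtain m where m: "0 < m" "\<And>x. x \<in> carrier_vec n \<Longrightarrow> m * vnorm2 x \<le> vnorm2 (M *\<^sub>v x)"
    using invertible_mat_lower_bound[OF M] inv unfolding M_def by blast
  \<comment> \<open>A nonzero \<open>A\<close> excludes dimension zero; a unit vector then shows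
    that \<open>M\<close> has positive norm.\<close>
  have n0: "0 < n"
  proof (rule ccontr)
    assume "\<not> 0 < n"
    then have "A = 0\<^sub>m n n" using A by (auto intro!: eq_matI)
    then show False using A0 by simp
  qed
  have "m * vnorm2 (unit_vec n 0) \<le> mnorm2 M * vnorm2 (unit_vec n 0)"
    using m(2)[of "unit_vec n 0"] vnorm2_mult_mat_vec_le[OF M, of "unit_vec n 0"] by simp
  then have \<mu>: "0 < \<mu>" using m(1) vnorm2_unit_vec[OF n0] by (simp add: \<mu>_def)
  \<comment> \<open>\<open>k\<close> will bound |C|, \<open>s\<close> is the constant of
    \<open>mnorm2_solution_le\<close>, and \<open>x0\<close> will bound |X|.\<close>
  define k where "k = 2 * b * sqrt \<mu>"
  have k: "0 < k" using pos \<mu> by (simp add: k_def)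
  define s where "s = m / (2 * k)"
  have s: "0 < s" using m k by (simp add: s_def)
  define x0 where "x0 = 4 * sqrt \<beta> / s"
  have x0: "0 < x0" using \<beta> s by (simp add: x0_def)
  define \<kappa> where "\<kappa> = 16 * g + 2 * f + e + q"
  \<comment> \<open>The pair with m / 2 keeps C D C^T close enough to \<open>M\<close>, and the one
    with s / 2 absorbs the solve error when |X| is bounded. The others yield the hypotheses of
    \<open>residual_bound\<close>, with a priori bounds in place of computed norms.\<close>
  define S where "S = {(1, 1), (5 * real n * G, \<mu>), (5 * real n * G + 2 * a * \<mu>, m / 2), (c, 1), (e, 1), (f, 1),
    (2 * g, 1), (d * k, s / 2), (d * k * x0, sqrt \<beta>), (\<kappa> * x0\<^sup>2, \<tau> / 2), (p * k * x0, sqrt \<beta>)}"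
  have "finite S" by (simp add: S_def)
  moreover have "0 < t" if "(k', t) \<in> S" for k' t
    using that \<beta> \<mu> m s \<tau> by (auto simp: S_def)
  ultimately obtain u0 where u0: "0 < u0"
    and small: "\<And>u k t. 0 < u \<Longrightarrow> u \<le> u0 \<Longrightarrow> (k, t) \<in> S \<Longrightarrow> u * k \<le> t"
    using common_smallness[of S] by blast
  show ?thesis
  proof (rule that[OF u0])
    fix u \<theta> l :: real and r i :: nat and Ab C D Cb X W U \<Theta> :: "real mat" and v :: "real vec"
    assume u: "0 < u" "u \<le> u0" and fl: "fl_shifted u n A B \<sigma> Ab"
      and sf: "shifted_factor u n a b Ab C D" and sd: "semidef_factor u n r c B Cb"
      and fs: "factor_solve u n r d C Cb X" and pf: "product_formed u r e D X W"
      and eig: "eig_decomposed u r f g W U \<Theta>" and i: "i < r" and \<theta>: "\<theta> = \<Theta> $$ (i,i)"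
      and \<tau>\<theta>: "\<tau> \<le> \<bar>\<theta>\<bar>" and l: "l = (1 + \<sigma> * \<theta>) / \<theta>"
      and rec: "stable_recovery u n r p q C D X (col U i) v"
    have sm: "u * 1 \<le> 1" "u * (5 * real n * G) \<le> \<mu>" "u * (5 * real n * G + 2 * a * \<mu>) \<le> m / 2" "u * c \<le> 1"
      "u * e \<le> 1" "u * f \<le> 1" "u * (2 * g) \<le> 1" "u * (d * k) \<le> s / 2" "u * (d * k * x0) \<le> sqrt \<beta>"
      "u * (\<kappa> * x0\<^sup>2) \<le> \<tau> / 2" "u * (p * k * x0) \<le> sqrt \<beta>"
      by (rule small[OF u]; simp add: S_def)+
    have u1: "u \<le> 1" using sm(1) by simp
    have \<theta>0: "\<theta> \<noteq> 0" using \<tau> \<tau>\<theta> by auto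
    have Ab: "Ab \<in> carrier_mat n n" using fl by (simp add: fl_shifted_def)
    have C: "C \<in> carrier_mat n n" using sf by (simp add: shifted_factor_def)
    have Cb: "Cb \<in> carrier_mat n r" using sd by (simp add: semidef_factor_def)
    have X: "X \<in> carrier_mat n r" using fs by (simp add: factor_solve_def)
    have E0: "mnorm2 (Ab - M) \<le> u * (5 * real n * G)"
      using fl_shifted_error_max[OF fl A B _ u1] u by (simp add: M_def G_def)
    have close: "mnorm2 (Ab - M) \<le> mnorm2 M" using E0 sm(2) by (simp add: \<mu>_def)
    have b0: "0 \<le> b" and ua: "0 \<le> u * a" using pos u by simp_all
    note C_bounds = shifted_factor_bounds[OF sf Ab M close b0 ua, folded \<mu>_def, folded k_def]
    have Cn: "mnorm2 C \<le> k" by (rule C_bounds(4))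
    let ?G = "C * D * transpose_mat C"
    have "D \<in> carrier_mat n n" using sf by (simp add: shifted_factor_def)
    then have Gc: "?G \<in> carrier_mat n n" using C by simp
    have F: "mnorm2 (?G - M) \<le> m / 2"
    proof -
      have "?G - M = (Ab - M) - (Ab - ?G)" using Gc Ab M
        by (intro eq_matI) (auto simp del: assoc_mult_mat index_mult_mat(1))
      then have "mnorm2 (?G - M) \<le> mnorm2 (Ab - M) + mnorm2 (Ab - ?G)"
        using mnorm2_diff_le[OF minus_carrier_mat[OF M] minus_carrier_mat[OF Gc]] by metis
      then show ?thesis using E0 C_bounds(2) sm(3) by (simp add: algebra_simps)
    qed
    define x where "x = mnorm2 X"
    have x_nn: "0 \<le> x" by (simp add: x_def)
    \<comment> \<open>|X| occurs on both sides: s x is at most 2 |B|^(1/2) + (s / 2) x. Moving the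
      last term over gives \<open>x0\<close>.\<close>
    have xn: "x \<le> x0"
    proof -
      have "s * x \<le> mnorm2 (C * X)"
        unfolding s_def x_def by (rule mnorm2_solution_le[OF M C C_bounds(1) X m(2) F Cn m(1) k])
      also have "\<dots> \<le> mnorm2 Cb + u * d * mnorm2 C * x"
        unfolding x_def by (rule factor_solve_bound[OF fs C Cb])
      also have "mnorm2 Cb \<le> 2 * sqrt \<beta>" using semidef_factor_bound[OF sd B sm(4)] by (simp add: \<beta>_def)
      also have "u * d * mnorm2 C * x \<le> u * d * k * x"
        using Cn u pos x_nn by (intro mult_right_mono mult_left_mono) auto
      also have "u * d * k * x \<le> s / 2 * x"
        using sm(8) x_nn by (intro mult_right_mono) (simp_all add: mult_ac)
      finally have "s * x \<le> 4 * sqrt \<beta>" by simp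
      then show ?thesis using s by (simp add: x0_def field_simps)
    qed
    have Cx: "mnorm2 C * x \<le> k * x0" using Cn xn x_nn k by (intro mult_mono) auto
    have c6: "u * (d * mnorm2 C * x) \<le> sqrt \<beta>"
    proof -
      have "u * d * (mnorm2 C * x) \<le> u * d * (k * x0)" using Cx u pos by (intro mult_left_mono) auto
      then show ?thesis using sm(9) by (simp add: mult_ac)
    qed
    have c8: "u * (p * mnorm2 C * x) \<le> sqrt \<beta>"
    proof -
      have "u * p * (mnorm2 C * x) \<le> u * p * (k * x0)" using Cx u pos by (intro mult_left_mono) auto
      then show ?thesis using sm(11) by (simp add: mult_ac)
    qed
    \<comment> \<open>The lower bound \<tau> is what keeps this threshold independent of
      \<theta>.\<close>
    have c7: "u * (\<kappa> * x\<^sup>2) \<le> \<bar>\<theta>\<bar> / 2"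
    proof -
      have "x\<^sup>2 \<le> x0\<^sup>2" by (rule power_mono[OF xn x_nn])
      then have "u * (\<kappa> * x\<^sup>2) \<le> u * (\<kappa> * x0\<^sup>2)"
        using u pos by (intro mult_left_mono) (auto simp: \<kappa>_def)
      then show ?thesis using sm(10) \<tau>\<theta> by linarith
    qed
    have "vnorm2 (\<theta> \<cdot>\<^sub>v (M *\<^sub>v v) - B *\<^sub>v v)
      \<le> (u * c * \<beta> + residual_const n a b d e f g p q * u *
        (sqrt \<mu> * sqrt \<beta> * x + (\<mu> + G * (1 + 1 / \<bar>\<theta> * \<sigma>\<bar>)) * x\<^sup>2)) * vnorm2 v"
      using residual_bound[OF A B \<sigma> \<theta>0 pos fl sf sd fs pf eig i \<theta> rec u(1) u1] sm(2,4-7) c6 c7 c8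
      unfolding M_def \<beta>_def \<mu>_def G_def x_def \<kappa>_def by blast
    also have "u * c * \<beta> + residual_const n a b d e f g p q * u *
        (sqrt \<mu> * sqrt \<beta> * x + (\<mu> + G * (1 + 1 / \<bar>\<theta> * \<sigma>\<bar>)) * x\<^sup>2)
      = bracket A B \<sigma> u c (residual_const n a b d e f g p q * u) l x * \<beta>"
      using bracket_mult_mnorm2[OF \<sigma> \<theta>0 l, of B A] \<beta> \<mu>
      unfolding \<beta>_def \<mu>_def G_def M_def by simp
    finally show "vnorm2 (\<theta> \<cdot>\<^sub>v ((A - \<sigma> \<cdot>\<^sub>m B) *\<^sub>v v) - B *\<^sub>v v)
       \<le> bracket A B \<sigma> u c (residual_const n a b d e f g p q * u) l (mnorm2 X) * mnorm2 B * vnorm2 v"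
      by (simp only: M_def x_def \<beta>_def)
  qed
qed

section \<open>The two forms of the final bound\<close>

lemma pencil_mult_vec:
  fixes \<theta> \<sigma> :: real
  assumes A: "A \<in> carrier_mat n n" and B: "B \<in> carrier_mat n n" and v: "v \<in> carrier_vec n"
  shows "(\<theta> \<cdot>\<^sub>m A - (1 + \<sigma> * \<theta>) \<cdot>\<^sub>m B) *\<^sub>v v = \<theta> \<cdot>\<^sub>v ((A - \<sigma> \<cdot>\<^sub>m B) *\<^sub>v v) - B *\<^sub>v v"
proof -
  have smult: "(t \<cdot>\<^sub>m N) *\<^sub>v v = t \<cdot>\<^sub>v (N *\<^sub>v v)" if "N \<in> carrier_mat n n" for t and N :: "real mat"
    using that v by (auto intro!: eq_vecI)
  have "\<theta> \<cdot>\<^sub>v h - (1 + \<sigma> * \<theta>) \<cdot>\<^sub>v w = \<theta> \<cdot>\<^sub>v (h - \<sigma> \<cdot>\<^sub>v w) - w"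
    if "h \<in> carrier_vec n" "w \<in> carrier_vec n" for h w
    using that by (auto intro!: eq_vecI simp: algebra_simps)
  from this[OF mult_mat_vec_carrier[OF A v] mult_mat_vec_carrier[OF B v]] show ?thesis
    using minus_mult_distrib_mat_vec[OF smult_carrier_mat[OF A] smult_carrier_mat[OF B] v, of \<theta> "1 + \<sigma> * \<theta>"]
      minus_mult_distrib_mat_vec[OF A smult_carrier_mat[OF B] v, of \<sigma>] smult[OF A] smult[OF B] by simp
qed

text \<open>The order of quantifiers encodes the O-terms. \<open>h\<close> is chosen as a function
  of the dimension before \<open>c\<close> and the matrices; \<open>K\<close> and \<open>u0\<close>
  come after \<open>c\<close>, \<open>A\<close>, \<open>B\<close>, \<sigma> and the lower bound
  \<tau> for |\<theta>|, but before \<open>u\<close> and every computed quantity.\<close>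

theorem theorem5p2:
  fixes a b d e f g p q :: "nat \<Rightarrow> real"
  assumes pos: "\<And>n. 0 < a n" "\<And>n. 0 < b n" "\<And>n. 0 < d n" "\<And>n. 0 < e n"
    "\<And>n. 0 < f n" "\<And>n. 0 < g n" "\<And>n. 0 < p n" "\<And>n. 0 < q n"
  shows "\<exists>h :: nat \<Rightarrow> real. (\<forall>n. 0 < h n) \<and>
    (\<forall>c :: nat \<Rightarrow> real. (\<forall>n. 0 < c n) \<longrightarrow>
    (\<forall>(n::nat) (A::real mat) (B::real mat) (\<sigma>::real) (\<tau>::real).
      A \<in> carrier_mat n n \<and> B \<in> carrier_mat n n \<and> A \<noteq> 0\<^sub>m n n \<and> B \<noteq> 0\<^sub>m n n \<and>
      sym_mat A \<and> sym_mat B \<and> pos_semidef n B \<and> \<sigma> \<noteq> 0 \<and> invertible_mat (A - \<sigma> \<cdot>\<^sub>m B) \<and> 0 < \<tau> \<longrightarrow>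
    (\<exists>K u0 :: real. 0 < K \<and> 0 < u0 \<and>
    (\<forall>(u::real) (r::nat) Ab Ca Da Cb X W U \<Theta> (i::nat) (v::real vec) (\<theta>::real) (l::real).
      0 < u \<and> u \<le> u0 \<and> r \<le> n \<and>
      fl_shifted u n A B \<sigma> Ab \<and>
      shifted_factor u n (a n) (b n) Ab Ca Da \<and>
      semidef_factor u n r (c n) B Cb \<and>
      factor_solve u n r (d n) Ca Cb X \<and>
      product_formed u r (e n) Da X W \<and>
      eig_decomposed u r (f n) (g n) W U \<Theta> \<and>
      i < r \<and> \<theta> = \<Theta> $$ (i,i) \<and> \<theta> \<noteq> 0 \<and> \<tau> \<le> \<bar>\<theta>\<bar> \<and>
      l = (1 + \<sigma> * \<theta>) / \<theta> \<and> l \<noteq> 0 \<and>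
      stable_recovery u n r (p n) (q n) Ca Da X (col U i) v \<longrightarrow>
      vnorm2 ((\<theta> \<cdot>\<^sub>m A - (1 + \<sigma> * \<theta>) \<cdot>\<^sub>m B) *\<^sub>v v)
        \<le> \<bar>1 + \<sigma> * \<theta>\<bar> * \<bar>1 - \<sigma> / l\<bar> * bracket A B \<sigma> u (c n) (h n * u) l (mnorm2 X)
            * mnorm2 B * vnorm2 v + K * u\<^sup>2 * vnorm2 v \<and>
      vnorm2 ((\<theta> \<cdot>\<^sub>m A - (1 + \<sigma> * \<theta>) \<cdot>\<^sub>m B) *\<^sub>v v)
        \<le> \<bar>\<theta>\<bar> * \<bar>1 - l / \<sigma>\<bar> * \<bar>sigma0 A B \<sigma>\<bar> * bracket A B \<sigma> u (c n) (h n * u) l (mnorm2 X)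
            * mnorm2 A * vnorm2 v + K * u\<^sup>2 * vnorm2 v))))"
proof (intro exI[of _ "\<lambda>n. residual_const n (a n) (b n) (d n) (e n) (f n) (g n) (p n) (q n)"] conjI allI impI)
  fix n
  show "0 < residual_const n (a n) (b n) (d n) (e n) (f n) (g n) (p n) (q n)"
    by (rule residual_const_pos[OF pos])
next
  fix c :: "nat \<Rightarrow> real" and n :: nat and A B :: "real mat" and \<sigma> \<tau> :: real
  assume "A \<in> carrier_mat n n \<and> B \<in> carrier_mat n n \<and> A \<noteq> 0\<^sub>m n n \<and> B \<noteq> 0\<^sub>m n n \<and>
    sym_mat A \<and> sym_mat B \<and> pos_semidef n B \<and> \<sigma> \<noteq> 0 \<and> invertible_mat (A - \<sigma> \<cdot>\<^sub>m B) \<and> 0 < \<tau>"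
  then have A: "A \<in> carrier_mat n n" and B: "B \<in> carrier_mat n n"
    and A0: "A \<noteq> 0\<^sub>m n n" and B0: "B \<noteq> 0\<^sub>m n n" and \<sigma>: "\<sigma> \<noteq> 0"
    and inv: "invertible_mat (A - \<sigma> \<cdot>\<^sub>m B)" and \<tau>: "0 < \<tau>" by blast+
  let ?h = "residual_const n (a n) (b n) (d n) (e n) (f n) (g n) (p n) (q n)"
  have A_pos: "0 < mnorm2 A" by (rule mnorm2_pos[OF A A0])
  obtain u0 where u0: "0 < u0" and bound: "\<And>u r Ab C D Cb X W U \<Theta> i v \<theta> l.
      \<lbrakk>0 < u; u \<le> u0; fl_shifted u n A B \<sigma> Ab;
      shifted_factor u n (a n) (b n) Ab C D; semidef_factor u n r (c n) B Cb; factor_solve u n r (d n) C Cb X;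
      product_formed u r (e n) D X W; eig_decomposed u r (f n) (g n) W U \<Theta>; i < r; \<theta> = \<Theta> $$ (i,i);
      \<tau> \<le> \<bar>\<theta>\<bar>; l = (1 + \<sigma> * \<theta>) / \<theta>; stable_recovery u n r (p n) (q n) C D X (col U i) v\<rbrakk>
     \<Longrightarrow> vnorm2 (\<theta> \<cdot>\<^sub>v ((A - \<sigma> \<cdot>\<^sub>m B) *\<^sub>v v) - B *\<^sub>v v)
       \<le> bracket A B \<sigma> u (c n) (?h * u) l (mnorm2 X) * mnorm2 B * vnorm2 v"
    using residual_bound_uniform[OF A B A0 B0 \<sigma> inv \<tau> pos(1)[of n] pos(2)[of n] pos(3)[of n] pos(4)[of n]
        pos(5)[of n] pos(6)[of n] pos(7)[of n] pos(8)[of n], of "c n"] by metis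
  show "\<exists>K u0 :: real. 0 < K \<and> 0 < u0 \<and>
    (\<forall>(u::real) (r::nat) Ab Ca Da Cb X W U \<Theta> (i::nat) (v::real vec) (\<theta>::real) (l::real).
      0 < u \<and> u \<le> u0 \<and> r \<le> n \<and>
      fl_shifted u n A B \<sigma> Ab \<and>
      shifted_factor u n (a n) (b n) Ab Ca Da \<and>
      semidef_factor u n r (c n) B Cb \<and>
      factor_solve u n r (d n) Ca Cb X \<and>
      product_formed u r (e n) Da X W \<and>
      eig_decomposed u r (f n) (g n) W U \<Theta> \<and>
      i < r \<and> \<theta> = \<Theta> $$ (i,i) \<and> \<theta> \<noteq> 0 \<and> \<tau> \<le> \<bar>\<theta>\<bar> \<and>
      l = (1 + \<sigma> * \<theta>) / \<theta> \<and> l \<noteq> 0 \<and>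
      stable_recovery u n r (p n) (q n) Ca Da X (col U i) v \<longrightarrow>
      vnorm2 ((\<theta> \<cdot>\<^sub>m A - (1 + \<sigma> * \<theta>) \<cdot>\<^sub>m B) *\<^sub>v v)
        \<le> \<bar>1 + \<sigma> * \<theta>\<bar> * \<bar>1 - \<sigma> / l\<bar> * bracket A B \<sigma> u (c n) (?h * u) l (mnorm2 X)
            * mnorm2 B * vnorm2 v + K * u\<^sup>2 * vnorm2 v \<and>
      vnorm2 ((\<theta> \<cdot>\<^sub>m A - (1 + \<sigma> * \<theta>) \<cdot>\<^sub>m B) *\<^sub>v v)
        \<le> \<bar>\<theta>\<bar> * \<bar>1 - l / \<sigma>\<bar> * \<bar>sigma0 A B \<sigma>\<bar> * bracket A B \<sigma> u (c n) (?h * u) l (mnorm2 X)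
            * mnorm2 A * vnorm2 v + K * u\<^sup>2 * vnorm2 v)"
  \<comment> \<open>The second-order terms are already absorbed below \<open>u0\<close>, so any
    positive \<open>K\<close> serves; 1 is taken.\<close>
  proof (rule exI[of _ "1::real"], rule exI[of _ u0], rule conjI, simp,
      rule conjI[OF u0], intro allI impI, elim conjE)
    fix u \<theta> l :: real and r i :: nat and Ab Ca Da Cb X W U \<Theta> :: "real mat" and v :: "real vec"
    assume hyps: "0 < u" "u \<le> u0" "fl_shifted u n A B \<sigma> Ab"
      "shifted_factor u n (a n) (b n) Ab Ca Da" "semidef_factor u n r (c n) B Cb"
      "factor_solve u n r (d n) Ca Cb X" "product_formed u r (e n) Da X W"
      "eig_decomposed u r (f n) (g n) W U \<Theta>" "i < r" "\<theta> = \<Theta> $$ (i,i)" "\<tau> \<le> \<bar>\<theta>\<bar>"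
      "l = (1 + \<sigma> * \<theta>) / \<theta>" "stable_recovery u n r (p n) (q n) Ca Da X (col U i) v"
      and \<theta>0: "\<theta> \<noteq> 0" and l0: "l \<noteq> 0"
    let ?w = "vnorm2 ((\<theta> \<cdot>\<^sub>m A - (1 + \<sigma> * \<theta>) \<cdot>\<^sub>m B) *\<^sub>v v)"
    let ?b = "bracket A B \<sigma> u (c n) (?h * u) l (mnorm2 X)"
    have v: "v \<in> carrier_vec n" using hyps(13) by (simp add: stable_recovery_def)
    have w: "?w \<le> ?b * mnorm2 B * vnorm2 v + 1 * u\<^sup>2 * vnorm2 v"
      using bound[OF hyps] pencil_mult_vec[OF A B v] by (simp add: add_increasing2)
    \<comment> \<open>A nonzero \<open>l\<close> makes \<sigma> / l a genuine quotient, and 1 -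
      \<sigma> / l is then the reciprocal of 1 + \<sigma> \<theta>.\<close>
    have nz: "1 + \<sigma> * \<theta> \<noteq> 0" using l0 hyps(12) by auto
    have "(1 + \<sigma> * \<theta>) * (1 - \<sigma> / l) = 1" using nz \<theta>0 unfolding hyps(12) by (simp add: field_simps)
    then have c1: "\<bar>1 + \<sigma> * \<theta>\<bar> * \<bar>1 - \<sigma> / l\<bar> = 1" by (simp flip: abs_mult)
    \<comment> \<open>\<theta> (1 - l / \<sigma>) = - 1 / \<sigma>, and \<open>sigma0\<close> times
      |A| is \<sigma> |B|. The second prefactor thus only rewrites |B|.\<close>
    have "\<theta> * (1 - l / \<sigma>) * sigma0 A B \<sigma> * mnorm2 A = - mnorm2 B"
      using \<sigma> \<theta>0 A_pos unfolding hyps(12) sigma0_def by (simp add: field_simps)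
    then have "\<bar>\<theta> * (1 - l / \<sigma>) * sigma0 A B \<sigma> * mnorm2 A\<bar> = mnorm2 B" by simp
    then have c2: "\<bar>\<theta>\<bar> * \<bar>1 - l / \<sigma>\<bar> * \<bar>sigma0 A B \<sigma>\<bar> * mnorm2 A = mnorm2 B"
      by (simp add: abs_mult)
    have "\<bar>\<theta>\<bar> * \<bar>1 - l / \<sigma>\<bar> * \<bar>sigma0 A B \<sigma>\<bar> * ?b * mnorm2 A
        = ?b * (\<bar>\<theta>\<bar> * \<bar>1 - l / \<sigma>\<bar> * \<bar>sigma0 A B \<sigma>\<bar> * mnorm2 A)" by (simp only: mult_ac)
    then have c2': "\<bar>\<theta>\<bar> * \<bar>1 - l / \<sigma>\<bar> * \<bar>sigma0 A B \<sigma>\<bar> * ?b * mnorm2 A = ?b * mnorm2 B"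
      unfolding c2 .
    show "?w \<le> \<bar>1 + \<sigma> * \<theta>\<bar> * \<bar>1 - \<sigma> / l\<bar> * ?b * mnorm2 B * vnorm2 v + 1 * u\<^sup>2 * vnorm2 v \<and>
      ?w \<le> \<bar>\<theta>\<bar> * \<bar>1 - l / \<sigma>\<bar> * \<bar>sigma0 A B \<sigma>\<bar> * ?b * mnorm2 A * vnorm2 v + 1 * u\<^sup>2 * vnorm2 v"
      unfolding c1 c2' using w by simp
  qed
qed

end
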